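(* Let $X$ be a Polish space and let $f:X\to\omega^\omega$ be a Borel function. If $f$ is not $\sigma$-continuous, then there exist topological embeddings $\varphi:(\omega+1)^\omega\to X$ and $\psi:\omega^\omega\to\omega^\omega$ such that $\psi\circ P=f\circ\varphi$.
   Context: A Borel function $f:X\to Y$ between Polish spaces is called $\sigma$-continuous if there is a countable cover $X=\bigcup_{n} X_n$ (with arbitrary sets $X_n$) such that $f\upharpoonright X_n$ is continuous for each $n$. The space $(\omega+1)^\omega$ carries the product topology, where $\omega+1$ has the order topology; $\omega^\omega$ carries the product topology of discrete spaces. The Pawlikowski function $P:(\omega+1)^\omega\to\omega^\omega$ is defined by $P(x)(n)=x(n)+1$ if $x(n)<\omega$, and $P(x)(n)=0$ if $x(n)=\omega$. A topological embedding is a map that is a homeomorphism onto its image. *)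

theory Defs
  imports "HOL-Analysis.Analysis"
begin

text \<open>
  All spaces are types carrying their type-class topology: \<^typ>\<open>nat\<close> is discrete,
  \<^typ>\<open>enat\<close> (the ordinal \<open>\<omega> + 1\<close>) has its order topology, and function spaces
  have the product topology.
\<close>

definition sigma_continuous :: "('a::topological_space \<Rightarrow> 'b::topological_space) \<Rightarrow> bool" where
  "sigma_continuous f \<longleftrightarrow>
     (\<exists>C :: nat \<Rightarrow> 'a set. (\<Union>n. C n) = UNIV \<and> (\<forall>n. continuous_on (C n) f))"

definition pawlikowski :: "(nat \<Rightarrow> enat) \<Rightarrow> (nat \<Rightarrow> nat)" where
  "pawlikowski x = (\<lambda>n. case x n of enat k \<Rightarrow> k + 1 | \<infinity> \<Rightarrow> 0)"

end

theory Submission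
  imports Defs
begin

text \<open>
  Lift \<open>f\<close> along a continuous surjection \<open>p\<close> from the Baire space such that \<open>F = f \<circ> p\<close> is continuous,
  and call \<open>A\<close> small if \<open>f\<close> is \<open>\<sigma>\<close>-continuous on \<open>p ` A\<close>. A set that is not small has a subset \<open>B\<close>
  that is not small and a coordinate of \<open>F\<close>, constant on \<open>B\<close>, such that all points of \<open>p ` B\<close> are limits
  of \<open>p\<close>-images of points of \<open>A\<close> at which the coordinate has another value. Iterating this gives
  chains of sets, each one accumulating at every point of the next one and separated from it by finitely many coordinates
  of \<open>F\<close>; a chain survives splitting one of its members into two pieces if the right piece is kept.

  The point attached to \<open>y \<in> (\<omega> + 1)\<^sup>\<omega>\<close> is found by a fusion over finite truncations of \<open>y\<close>, in which every
  truncation carries a chain with one reserve set for each coordinate that is still possibly infinite. When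
  a coordinate turns out to be \<open>n\<close>, the construction moves to the corresponding reserve set: this keeps
  the \<open>p\<close>-image close, so that the limit is continuous in \<open>y\<close>, but changes \<open>F\<close>, so that \<open>F\<close>
  determines the exact values of \<open>y\<close>.
\<close>

section \<open>Continuous liftings of Borel functions\<close>

instantiation nat :: metric_space
begin

definition dist_nat_def: "dist m n = \<bar>real m - real n\<bar>"

definition uniformity_nat_def:
  "(uniformity :: (nat \<times> nat) filter) = (INF e\<in>{0<..}. principal {(m, n). dist m n < e})"

lemma dist_nat_less_1: "dist m n < 1 \<Longrightarrow> m = (n::nat)"
  by (simp add: dist_nat_def)

instance
proof
  show "open U \<longleftrightarrow> (\<forall>m\<in>U. \<forall>\<^sub>F (m', n) in uniformity. m' = m \<longrightarrow> n \<in> U)" for U :: "nat set"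
  proof -
    have "\<forall>\<^sub>F (m', n) in uniformity. m' = m \<longrightarrow> n \<in> U" if "m \<in> U" for m
    proof -
      have "\<forall>\<^sub>F (m', n) in uniformity. dist m' (n::nat) < 1"
        unfolding uniformity_nat_def
        by (rule eventually_INF1[of 1]) (auto simp: eventually_principal)
      then show ?thesis
        by eventually_elim (use that dist_nat_less_1 in auto)
    qed
    then show ?thesis by (simp add: open_discrete)
  qed
qed (auto simp: dist_nat_def uniformity_nat_def)

end

instance nat :: polish_space
proof
  fix X :: "nat \<Rightarrow> nat" assume "Cauchy X"
  then obtain N where N: "\<And>m n. m \<ge> N \<Longrightarrow> n \<ge> N \<Longrightarrow> dist (X m) (X n) < 1"
    unfolding Cauchy_def by (meson zero_less_one)
  have "X n = X N" if "n \<ge> N" for n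
    using N[OF that order_refl] by (rule dist_nat_less_1)
  then have "X \<longlonglongrightarrow> X N"
    by (intro tendsto_eventually eventually_sequentiallyI)
  then show "convergent X" by (auto simp: convergent_def)
qed

lemma open_agree:
  fixes x :: "nat \<Rightarrow> 'b::discrete_topology"
  shows "open {y. \<forall>i<n. y i = x i}"
proof -
  have "open (\<Inter>i<n. (\<lambda>y::nat \<Rightarrow> 'b. y i) -` {x i})"
    by (intro open_INT ballI open_vimage) (auto simp: open_discrete)
  also have "(\<Inter>i<n. (\<lambda>y::nat \<Rightarrow> 'b. y i) -` {x i}) = {y. \<forall>i<n. y i = x i}" by auto
  finally show ?thesis .
qed

lemma continuous_into_discrete:
  fixes g :: "'a::topological_space \<Rightarrow> 'b::discrete_topology"
  assumes "\<And>k. open (g -` {k})"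
  shows "continuous_on UNIV g"
proof -
  have "open (g -` B)" for B
  proof -
    have "open (\<Union>k\<in>B. g -` {k})" using assms by (intro open_UN) blast
    also have "(\<Union>k\<in>B. g -` {k}) = g -` B" by auto
    finally show ?thesis .
  qed
  then show ?thesis by (simp add: continuous_on_open_vimage[OF open_UNIV])
qed

text \<open>A point of the Baire space codes a sequence in a countable dense subset of
  \<open>S\<close>. Moves that are too long are ignored, so every code converges, and closedness of
  \<open>S\<close> keeps the limit inside.\<close>

lemma closed_set_continuous_image:
  fixes S :: "'a::polish_space set"
  assumes "closed S" "S \<noteq> {}"
  obtains r :: "(nat \<Rightarrow> nat) \<Rightarrow> 'a" where "continuous_on UNIV r" "range r = S"
proof -
  obtain \<B> :: "'a set set" where \<B>: "countable \<B>" "topological_basis \<B>"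
    using ex_countable_basis by blast
  define D where "D = (\<lambda>B. SOME x. x \<in> B \<inter> S) ` {B \<in> \<B>. B \<inter> S \<noteq> {}}"
  have some: "(SOME x. x \<in> B \<inter> S) \<in> B \<inter> S" if "B \<inter> S \<noteq> {}" for B
    using that by (metis some_in_eq)
  have D: "countable D" "D \<subseteq> S"
    using \<B> some by (auto simp: D_def)
  have near: "\<exists>b\<in>D. dist b a < e" if "a \<in> S" "e > 0" for a e
  proof -
    obtain B where B: "B \<in> \<B>" "a \<in> B" "B \<subseteq> ball a e"
      using \<B>(2) \<open>e > 0\<close> by (meson centre_in_ball open_ball topological_basisE)
    then have "(SOME x. x \<in> B \<inter> S) \<in> D" "(SOME x. x \<in> B \<inter> S) \<in> B"
      using \<open>a \<in> S\<close> some[of B] by (auto simp: D_def)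
    then show ?thesis using B(3) by (metis dist_commute mem_ball subsetD)
  qed
  have "D \<noteq> {}" using near assms(2) zero_less_one by blast
  define d where "d = from_nat_into D"
  have d: "d k \<in> D" for k
    using \<open>D \<noteq> {}\<close> by (simp add: d_def from_nat_into)
  have dense: "\<exists>k. dist (d k) a < e" if "a \<in> S" "e > 0" for a e
  proof -
    obtain b where "b \<in> D" "dist b a < e"
      using near \<open>a \<in> S\<close> \<open>e > 0\<close> by blast
    then show ?thesis
      using from_nat_into_surj[OF D(1)] by (auto simp: d_def)
  qed
  define q where "q x = rec_nat (d (x 0))
      (\<lambda>n b. if dist (d (x (Suc n))) b \<le> (1/2)^n then d (x (Suc n)) else b)" for x
  have q0: "q x 0 = d (x 0)" and
    qS: "q x (Suc n) = (if dist (d (x (Suc n))) (q x n) \<le> (1/2)^n then d (x (Suc n)) else q x n)" for x n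
    by (auto simp: q_def)
  have qD: "q x n \<in> S" for x n
    by (induction n) (use d D in \<open>auto simp: q0 qS\<close>)
  have step: "dist (q x (Suc n)) (q x n) \<le> (1/2)^n" for x n
    by (auto simp: qS)
  \<comment> \<open>The subtracted term, the tail of the geometric series from \<open>n + k\<close>
    on, makes the induction go through.\<close>
  have dist_add: "dist (q x (n + k)) (q x n) \<le> 2 * (1/2)^n - 2 * (1/2)^(n+k)" for x n k
  proof (induction k)
    case (Suc k)
    have "dist (q x (n + Suc k)) (q x n) \<le> dist (q x (Suc (n + k))) (q x (n+k)) + dist (q x (n+k)) (q x n)"
      using dist_triangle by simp
    then show ?case using Suc step[of x "n+k"] by simp
  qed auto
  have dist_le: "dist (q x m) (q x n) \<le> 2 * (1/2)^n" if "n \<le> m" for x n m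
  proof -
    have "0 \<le> (1/2::real)^(n + (m - n))" by simp
    then have "dist (q x (n + (m - n))) (q x n) \<le> 2 * (1/2)^n"
      using dist_add[of x n "m - n"] by linarith
    then show ?thesis using that by simp
  qed
  have small: "\<exists>n. 4 * (1/2)^n < e" if "e > 0" for e :: real
  proof -
    obtain n where "(1/2)^n < e/4"
      using real_arch_pow_inv[of "e/4" "1/2"] \<open>e > 0\<close> by auto
    then show ?thesis by (intro exI[of _ n]) simp
  qed
  have "Cauchy (q x)" for x
  proof (rule metric_CauchyI)
    fix e :: real assume "0 < e"
    then obtain n where n: "4 * (1/2)^n < e" using small by blast
    have "dist (q x m) (q x k) < e" if "m \<ge> n" "k \<ge> n" for m k
      using dist_le[OF that(1), of x] dist_le[OF that(2), of x] n
        dist_triangle2[of "q x m" "q x k" "q x n"] by simp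
    then show "\<exists>M. \<forall>m\<ge>M. \<forall>n\<ge>M. dist (q x m) (q x n) < e" by blast
  qed
  then have "\<forall>x. \<exists>l. q x \<longlonglongrightarrow> l"
    by (simp add: Cauchy_convergent_iff convergent_def)
  then obtain r where r: "\<And>x. q x \<longlonglongrightarrow> r x" by metis
  have rS: "r x \<in> S" for x
    using closed_sequentially[OF assms(1) _ r] qD by blast
  have rq: "dist (r x) (q x n) \<le> 2 * (1/2)^n" for x n
  proof (rule tendsto_upperbound)
    show "(\<lambda>m. dist (q x m) (q x n)) \<longlonglongrightarrow> dist (r x) (q x n)"
      by (intro tendsto_intros r)
    show "\<forall>\<^sub>F m in sequentially. dist (q x m) (q x n) \<le> 2 * (1/2)^n"
      using dist_le eventually_sequentially by blast
  qed simp
  have q_cong: "q x n = q y n" if "\<And>i. i \<le> n \<Longrightarrow> x i = y i" for x y n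
    using that by (induction n) (auto simp: q0 qS)
  have "continuous_on UNIV r"
    unfolding continuous_on_topological
  proof (intro ballI allI impI)
    fix x B assume "open B" "r x \<in> B"
    then obtain e where e: "e > 0" "ball (r x) e \<subseteq> B" by (meson openE)
    then obtain n where n: "4 * (1/2)^n < e" using small by blast
    define A where "A = {y. \<forall>i<Suc n. y i = x i}"
    have "open A" unfolding A_def by (rule open_agree)
    moreover have "r y \<in> B" if "y \<in> A" for y
    proof -
      have "q y n = q x n" using that by (intro q_cong) (auto simp: A_def)
      then have "dist (r x) (r y) < e"
        using rq[of x n] rq[of y n] n dist_triangle2[of "r x" "r y" "q x n"] by simp
      then show ?thesis using e by auto
    qed
    ultimately show "\<exists>A. open A \<and> x \<in> A \<and> (\<forall>y\<in>UNIV. y \<in> A \<longrightarrow> r y \<in> B)"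
      by (intro exI[of _ A]) (auto simp: A_def)
  qed
  moreover have "S \<subseteq> range r"
  proof
    fix a assume "a \<in> S"
    \<comment> \<open>With half of the allowed distance, consecutive approximations differ by at
      most \<open>(1/2)^n\<close>, so no move is ignored and \<open>q x n\<close> is
      \<open>d (x n)\<close>.\<close>
    then have "\<exists>k. dist (d k) a < (1/2)^n / 2" for n
      by (intro dense) auto
    then obtain x where x: "dist (d (x n)) a < (1/2)^n / 2" for n by metis
    have "q x n = d (x n)" for n
    proof (induction n)
      case (Suc n)
      have "dist (d (x (Suc n))) (d (x n)) \<le> dist (d (x (Suc n))) a + dist (d (x n)) a"
        by (rule dist_triangle2)
      also have "\<dots> \<le> (1/2)^n / 4 + (1/2)^n / 2"
        using x[of n] x[of "Suc n"] by simp
      also have "\<dots> \<le> (1/2)^n" by simp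
      finally show ?case using Suc by (simp add: qS)
    qed (simp add: q0)
    moreover have "(\<lambda>n. d (x n)) \<longlonglongrightarrow> a"
    proof (rule metric_LIMSEQ_I)
      fix e :: real assume "0 < e"
      then obtain n where n: "4 * (1/2)^n < e" using small by blast
      have "dist (d (x m)) a < e" if "m \<ge> n" for m
      proof -
        have "(1/2::real)^m \<le> (1/2)^n" using that by (intro power_decreasing) auto
        moreover have "0 < (1/2::real)^m" by simp
        ultimately show ?thesis using x[of m] n by linarith
      qed
      then show "\<exists>M. \<forall>m\<ge>M. dist (d (x m)) a < e" by blast
    qed
    ultimately have "r x = a" using r[of x] LIMSEQ_unique by (metis (no_types, lifting) ext)
    then show "a \<in> range r" by auto
  qed
  ultimately show ?thesis using that rS by blast
qed

text \<open>The complement of a closed set is a countable union of closed sets. The first coordinate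
  of a code selects one of these or \<open>T\<close> itself and the other coordinates run through
  the selected set, so the preimage of \<open>T\<close> consists of the codes starting with
  0.\<close>

lemma surj_clopen_closed:
  fixes T :: "'a::polish_space set"
  assumes "closed T"
  obtains h :: "(nat \<Rightarrow> nat) \<Rightarrow> 'a"
  where "continuous_on UNIV h" "surj h" "open (h -` T)" "closed (h -` T)"
proof (cases "T = {} \<or> T = UNIV")
  case True
  obtain h :: "(nat \<Rightarrow> nat) \<Rightarrow> 'a" where "continuous_on UNIV h" "range h = UNIV"
    using closed_set_continuous_image[of "UNIV :: 'a set"] by auto
  then show ?thesis using that True by auto
next
  case False
  define C where "C n = (if n = 0 then T else {a. \<forall>b\<in>T. dist a b \<ge> 1 / real n})" for n
  have "closed (C n)" for n
  proof (cases "n = 0")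
    case False
    have "C n = (\<Inter>b\<in>T. {a. dist a b \<ge> 1 / real n})"
      using False by (auto simp: C_def)
    then show ?thesis
      by (auto intro!: closed_INT closed_Collect_le continuous_intros)
  qed (simp add: C_def assms)
  moreover have C_disj: "C n \<inter> T = {}" if "n > 0" for n
    using that by (force simp: C_def)
  moreover have "\<exists>n>0. a \<in> C n" if "a \<notin> T" for a
  proof -
    obtain e where e: "e > 0" "ball a e \<subseteq> - T"
      using \<open>a \<notin> T\<close> assms by (metis ComplI open_Compl openE)
    then obtain n where n: "n > 0" "1 / real n < e"
      by (metis inverse_eq_divide reals_Archimedean2 ex_inverse_of_nat_less)
    have "1 / real n \<le> dist a b" if "b \<in> T" for b
      using e(2) n that by (force simp: subset_iff not_le)
    then show ?thesis using n by (auto simp: C_def intro!: exI[of _ n])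
  qed
  ultimately obtain C' :: "nat \<Rightarrow> 'a set" where C': "\<And>n. closed (C' n)" "\<And>n. C' n \<noteq> {}"
    "C' 0 = T" "\<And>n. n > 0 \<Longrightarrow> C' n \<inter> T = {}" "(\<Union>n. C' n) = UNIV"
  proof -
    assume closed: "\<And>n. closed (C n)" and disj: "\<And>n. n > 0 \<Longrightarrow> C n \<inter> T = {}"
      and cover: "\<And>a. a \<notin> T \<Longrightarrow> \<exists>n>0. a \<in> C n"
      and goal: "\<And>C' :: nat \<Rightarrow> 'a set. (\<And>n. closed (C' n)) \<Longrightarrow> (\<And>n. C' n \<noteq> {}) \<Longrightarrow> C' 0 = T
        \<Longrightarrow> (\<And>n. n > 0 \<Longrightarrow> C' n \<inter> T = {}) \<Longrightarrow> (\<Union>n. C' n) = UNIV \<Longrightarrow> thesis"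
    obtain n0 where n0: "n0 > 0" "C n0 \<noteq> {}" using cover False by (metis UNIV_eq_I empty_iff)
    \<comment> \<open>Only nonempty closed sets are images of the Baire space, so an empty layer is
      replaced by \<open>C n0\<close>, which is disjoint from \<open>T\<close> as well.\<close>
    define C' where "C' n = (if C n = {} then C n0 else C n)" for n
    have C0: "C' 0 = T" using False by (auto simp: C'_def C_def)
    have "\<exists>n. a \<in> C' n" for a
    proof (cases "a \<in> T")
      case True then show ?thesis using C0 by auto
    next
      case False
      then obtain n where "a \<in> C n" using cover by blast
      then show ?thesis by (auto simp: C'_def intro!: exI[of _ n])
    qed
    then have un: "(\<Union>n. C' n) = UNIV" by blast
    show thesis
    proof (rule goal[OF _ _ C0 _ un])
      show "closed (C' n)" "C' n \<noteq> {}" for n using closed n0 by (auto simp: C'_def)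
      show "C' n \<inter> T = {}" if "n > 0" for n using disj[OF that] disj[OF n0(1)] by (simp add: C'_def)
    qed
  qed
  have "\<exists>r :: nat \<Rightarrow> (nat \<Rightarrow> nat) \<Rightarrow> 'a. \<forall>n. continuous_on UNIV (r n) \<and> range (r n) = C' n"
    by (rule choice) (metis closed_set_continuous_image[OF C'(1,2)])
  then obtain r :: "nat \<Rightarrow> (nat \<Rightarrow> nat) \<Rightarrow> 'a"
    where r: "\<And>n. continuous_on UNIV (r n)" "\<And>n. range (r n) = C' n"
    by blast
  define h where "h x = r (x 0) (\<lambda>i. x (Suc i))" for x :: "nat \<Rightarrow> nat"
  have open0: "open {x::nat \<Rightarrow> nat. x 0 = k}" for k
    using open_agree[of "Suc 0" "\<lambda>_. k"] by simp
  have "continuous_on (\<Union>k\<in>UNIV. {x::nat \<Rightarrow> nat. x 0 = k}) h"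
  proof (rule continuous_on_open_UN)
    fix k
    have "continuous_on {x. x 0 = k} (\<lambda>x. r k (\<lambda>i. x (Suc i)))"
      by (intro continuous_on_compose2[OF r(1)] continuous_on_coordinatewise_then_product
            continuous_on_subset[OF continuous_on_product_coordinates]) auto
    then show "continuous_on {x. x 0 = k} h"
      by (rule continuous_on_eq) (auto simp: h_def)
  qed (use open0 in auto)
  moreover have "(\<Union>k\<in>UNIV. {x::nat \<Rightarrow> nat. x 0 = k}) = UNIV" by blast
  ultimately have "continuous_on UNIV h" by (simp only:)
  moreover have "surj h"
  proof -
    have "\<exists>x. h x = a" for a
    proof -
      obtain n where "a \<in> C' n" using C'(5) by blast
      then obtain z where "r n z = a" using r(2) by (metis rangeE)
      then have "h (case_nat n z) = a" by (simp add: h_def)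
      then show ?thesis by blast
    qed
    then show ?thesis by (metis surjI)
  qed
  moreover have "h -` T = {x. x 0 = 0}"
  proof -
    have "h x \<in> T \<longleftrightarrow> x 0 = 0" for x
    proof -
      have "h x \<in> C' (x 0)" using r(2)[of "x 0"] by (auto simp: h_def)
      then show ?thesis using C'(3) C'(4)[of "x 0"] by (cases "x 0 = 0") auto
    qed
    then show ?thesis by auto
  qed
  moreover have "closed {x::nat \<Rightarrow> nat. x 0 = 0}"
  proof -
    have "- {x::nat \<Rightarrow> nat. x 0 = 0} = (\<Union>k\<in>{0<..}. {x. x 0 = k})" by auto
    then show ?thesis using open0 by (auto simp: closed_def)
  qed
  ultimately show ?thesis using that open0 by simp
qed

section \<open>Continuous surjections that make Borel sets clopen\<close>

definition clopen_lift :: "'a::topological_space set \<Rightarrow> bool" where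
  "clopen_lift E \<longleftrightarrow> (\<exists>h :: (nat \<Rightarrow> nat) \<Rightarrow> 'a.
     continuous_on UNIV h \<and> surj h \<and> open (h -` E) \<and> closed (h -` E))"

lemma clopen_lift_Compl: "clopen_lift (- E) \<longleftrightarrow> clopen_lift E"
proof -
  have "open (h -` (- E)) \<and> closed (h -` (- E)) \<longleftrightarrow> open (h -` E) \<and> closed (h -` E)"
    for h :: "(nat \<Rightarrow> nat) \<Rightarrow> 'a"
    by (auto simp: vimage_Compl closed_def)
  then show ?thesis by (simp add: clopen_lift_def)
qed

lemma clopen_lift_closed: "closed T \<Longrightarrow> clopen_lift (T :: 'a::polish_space set)"
  using surj_clopen_closed[of T] unfolding clopen_lift_def by metis

text \<open>The countable fibre product of the individual lifts serves all sets at once. It is a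
  closed subset of a Polish space, hence again a continuous image of the Baire space.\<close>

lemma clopen_lift_sequence:
  fixes E :: "nat \<Rightarrow> 'a::polish_space set"
  assumes "\<And>n. clopen_lift (E n)"
  obtains g :: "(nat \<Rightarrow> nat) \<Rightarrow> 'a"
  where "continuous_on UNIV g" "surj g" "\<And>n. open (g -` E n)" "\<And>n. closed (g -` E n)"
proof -
  have "\<exists>h :: nat \<Rightarrow> (nat \<Rightarrow> nat) \<Rightarrow> 'a. \<forall>n. continuous_on UNIV (h n) \<and> surj (h n) \<and> open (h n -` E n) \<and> closed (h n -` E n)"
    by (rule choice) (use assms in \<open>auto simp: clopen_lift_def\<close>)
  then obtain h :: "nat \<Rightarrow> (nat \<Rightarrow> nat) \<Rightarrow> 'a" where h: "\<And>n. continuous_on UNIV (h n)"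
    "\<And>n. surj (h n)" "\<And>n. open (h n -` E n)" "\<And>n. closed (h n -` E n)"
    by metis
  define S where "S = {z :: nat \<Rightarrow> nat \<Rightarrow> nat. \<forall>n. h n (z n) = h 0 (z 0)}"
  have cont_h: "continuous_on UNIV (\<lambda>z::nat \<Rightarrow> nat \<Rightarrow> nat. h n (z n))" for n
    by (intro continuous_on_compose2[OF h(1)] continuous_on_product_coordinates) auto
  have "S = (\<Inter>n. {z. h n (z n) = h 0 (z 0)})" by (auto simp: S_def)
  then have "closed S"
    using cont_h by (auto intro!: closed_INT closed_Collect_eq)
  have lift: "\<exists>z\<in>S. h 0 (z 0) = a" for a
  proof -
    have "\<forall>n. \<exists>w. h n w = a" using h(2) by (metis surjD)
    then obtain z where "\<And>n. h n (z n) = a" by metis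
    then show ?thesis by (intro bexI[of _ z]) (auto simp: S_def)
  qed
  then have "S \<noteq> {}" by blast
  obtain r :: "(nat \<Rightarrow> nat) \<Rightarrow> nat \<Rightarrow> nat \<Rightarrow> nat" where r: "continuous_on UNIV r" "range r = S"
    using closed_set_continuous_image[OF \<open>closed S\<close> \<open>S \<noteq> {}\<close>] .
  define g where "g x = h 0 (r x 0)" for x
  have g: "g x = h n (r x n)" for x n
  proof -
    have "r x \<in> S" using r(2) by blast
    then have "h n (r x n) = h 0 (r x 0)" by (auto simp: S_def)
    then show ?thesis by (simp add: g_def)
  qed
  have cont_r: "continuous_on UNIV (\<lambda>x. r x n)" for n
    using r(1) by (rule continuous_on_product_then_coordinatewise)
  have vim: "g -` E n = (\<lambda>x. r x n) -` (h n -` E n)" for n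
    by (auto simp: g[of _ n])
  show ?thesis
  proof
    show "continuous_on UNIV g"
      unfolding g_def by (intro continuous_on_compose2[OF h(1) cont_r]) auto
    show "surj g"
    proof (rule surjI)
      show "g (SOME x. g x = a) = a" for a
        using lift[of a] r(2) unfolding g_def by (intro someI_ex[of "\<lambda>x. h 0 (r x 0) = a"]) blast
    qed
    show "open (g -` E n)" "closed (g -` E n)" for n
      unfolding vim by (intro open_vimage closed_vimage h(3,4) cont_r)+
  qed
qed

lemma clopen_lift_borel:
  fixes E :: "'a::polish_space set"
  assumes "E \<in> sets borel"
  shows "clopen_lift E"
proof -
  have "E \<in> sigma_sets UNIV {S. open S}"
    using assms by (simp add: borel_def)
  then show ?thesis
  proof induction
    case (Basic S)
    then have "clopen_lift (- S)" by (intro clopen_lift_closed closed_Compl) simp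
    then show ?case by (simp add: clopen_lift_Compl)
  next
    case Empty
    then show ?case by (intro clopen_lift_closed) simp
  next
    case (Compl S)
    then show ?case by (simp add: clopen_lift_Compl flip: Compl_eq_Diff_UNIV)
  next
    case (Union E)
    then obtain g :: "(nat \<Rightarrow> nat) \<Rightarrow> 'a" where g: "continuous_on UNIV g" "surj g"
      "\<And>n. open (g -` E n)"
      using clopen_lift_sequence by metis
    \<comment> \<open>After the first lift the union is merely open, but it is now an open subset of
      the Baire space, and a second lift makes it clopen.\<close>
    define V where "V = g -` (\<Union>n. E n)"
    have "open V" using g(3) by (auto simp: V_def vimage_UN)
    then have "clopen_lift V"
      using clopen_lift_closed[OF closed_Compl, of V] by (simp add: clopen_lift_Compl)
    then obtain k :: "(nat \<Rightarrow> nat) \<Rightarrow> nat \<Rightarrow> nat" where k: "continuous_on UNIV k" "surj k"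
      "open (k -` V)" "closed (k -` V)"
      unfolding clopen_lift_def by blast
    have "continuous_on UNIV (g \<circ> k)"
      using k(2) g(1) by (intro continuous_on_compose k(1)) simp
    moreover have "surj (g \<circ> k)" using k(2) g(2) by (rule comp_surj)
    moreover have "(g \<circ> k) -` (\<Union>n. E n) = k -` V" by (auto simp: V_def)
    ultimately show ?case using k(3,4) unfolding clopen_lift_def by metis
  qed
qed

text \<open>One lift opens the preimages of all the countably many sets \<open>{z. z i = k}\<close>,
  which makes every coordinate of \<open>f \<circ> p\<close> continuous.\<close>

lemma borel_continuous_lift:
  fixes f :: "'a::polish_space \<Rightarrow> nat \<Rightarrow> nat"
  assumes "f \<in> borel_measurable borel"
  obtains p :: "(nat \<Rightarrow> nat) \<Rightarrow> 'a"
  where "continuous_on UNIV p" "surj p" "continuous_on UNIV (f \<circ> p)"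
proof -
  define E where "E j = (case prod_decode j of (i, k) \<Rightarrow> f -` {z. z i = k})" for j
  have openE: "open {z :: nat \<Rightarrow> nat. z i = k}" for i k
  proof -
    have "open ((\<lambda>z :: nat \<Rightarrow> nat. z i) -` {k})"
      by (intro open_vimage) (auto simp: open_discrete)
    then show ?thesis by (simp add: vimage_def)
  qed
  have "clopen_lift (E j)" for j
    using measurable_sets[OF assms borel_open[OF openE]]
    by (intro clopen_lift_borel) (auto simp: E_def split: prod.split)
  then obtain p :: "(nat \<Rightarrow> nat) \<Rightarrow> 'a" where p: "continuous_on UNIV p" "surj p"
    "\<And>j. open (p -` E j)"
    using clopen_lift_sequence by metis
  have "continuous_on UNIV (\<lambda>x. f (p x) i)" for i
  proof (rule continuous_into_discrete)
    fix k
    have "(\<lambda>x. f (p x) i) -` {k} = p -` E (prod_encode (i, k))" by (auto simp: E_def)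
    then show "open ((\<lambda>x. f (p x) i) -` {k})" using p(3) by metis
  qed
  then have "continuous_on UNIV (f \<circ> p)"
    unfolding comp_def by (rule continuous_on_coordinatewise_then_product)
  with p(1,2) show ?thesis by (rule that)
qed

section \<open>Small sets and chains\<close>

text \<open>The fusion takes limits in the Baire space, where they exist as soon as each coordinate
  stabilises, and carries them to \<open>'a\<close> by \<open>p\<close>.\<close>

locale continuous_lift =
  fixes p :: "(nat \<Rightarrow> nat) \<Rightarrow> 'a::{metric_space, second_countable_topology}"
    and f :: "'a \<Rightarrow> nat \<Rightarrow> nat"
  assumes continuous_p: "continuous_on UNIV p"
    and continuous_fp: "continuous_on UNIV (f \<circ> p)"
    and surj_p: "surj p"
    and not_sigma_continuous: "\<not> sigma_continuous f"
begin

definition F :: "(nat \<Rightarrow> nat) \<Rightarrow> nat \<Rightarrow> nat" where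
  "F x = f (p x)"

definition small :: "(nat \<Rightarrow> nat) set \<Rightarrow> bool" where
  "small A \<longleftrightarrow> (\<exists>C :: nat \<Rightarrow> 'a set. p ` A \<subseteq> (\<Union>n. C n) \<and> (\<forall>n. continuous_on (C n) f))"

text \<open>In the Baire space \<open>F\<close> is continuous and a coordinate could not jump at a
  limit; hence neighbourhoods are taken in \<open>'a\<close>. The point \<open>x\<close> may lie
  outside \<open>A\<close>.\<close>

definition accum :: "(nat \<Rightarrow> nat) set \<Rightarrow> (nat \<Rightarrow> nat) set" where
  "accum A = {x. \<forall>U. open U \<longrightarrow> p x \<in> U \<longrightarrow> \<not> small (A \<inter> p -` U)}"

definition separated :: "nat \<Rightarrow> (nat \<Rightarrow> nat) set \<Rightarrow> (nat \<Rightarrow> nat) set \<Rightarrow> bool" where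
  "separated h A B \<longleftrightarrow> (\<forall>a\<in>A. \<forall>b\<in>B. \<exists>k<h. F a k \<noteq> F b k)"

text \<open>Earlier sets approach the points of later ones. The size requirement on the last set
  passes to all earlier sets by \<open>chain_not_small\<close>.\<close>

definition chain :: "nat \<Rightarrow> (nat \<Rightarrow> (nat \<Rightarrow> nat) set) \<Rightarrow> bool" where
  "chain m Y \<longleftrightarrow> \<not> small (Y m) \<and> (\<forall>j<m. Y (Suc j) \<subseteq> accum (Y j))"

section \<open>The sigma-ideal of small sets and its accumulation points\<close>

lemma small_mono: "small B \<Longrightarrow> A \<subseteq> B \<Longrightarrow> small A"
  unfolding small_def by (meson image_mono order_trans)

lemma not_small_UNIV: "\<not> small UNIV"
  using not_sigma_continuous surj_p unfolding small_def sigma_continuous_def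
  by (metis top.extremum_unique)

lemma small_if_continuous: "continuous_on (p ` A) f \<Longrightarrow> small A"
  unfolding small_def by (rule exI[of _ "\<lambda>_. p ` A"]) auto

lemma small_empty: "small {}"
  by (rule small_if_continuous) simp

lemma small_UN_nat:
  fixes A :: "nat \<Rightarrow> (nat \<Rightarrow> nat) set"
  assumes "\<And>n. small (A n)"
  shows "small (\<Union>n. A n)"
proof -
  have "\<exists>C :: nat \<Rightarrow> nat \<Rightarrow> 'a set. \<forall>n. p ` A n \<subseteq> (\<Union>k. C n k) \<and> (\<forall>k. continuous_on (C n k) f)"
    using assms unfolding small_def by (intro choice) blast
  then obtain C :: "nat \<Rightarrow> nat \<Rightarrow> 'a set"
    where C: "\<And>n. p ` A n \<subseteq> (\<Union>k. C n k)" "\<And>n k. continuous_on (C n k) f"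
    by blast
  define C' where "C' j = case_prod C (prod_decode j)" for j
  have "p ` (\<Union>n. A n) \<subseteq> (\<Union>j. C' j)"
  proof
    fix a assume "a \<in> p ` (\<Union>n. A n)"
    then obtain n k where "a \<in> C n k" using C(1) by blast
    then have "a \<in> C' (prod_encode (n, k))" by (simp add: C'_def)
    then show "a \<in> (\<Union>j. C' j)" by blast
  qed
  moreover have "continuous_on (C' j) f" for j
    using C(2) by (simp add: C'_def split: prod.split)
  ultimately show ?thesis unfolding small_def by (intro exI[of _ C'] conjI allI)
qed

lemma small_UN:
  assumes "countable I" "\<And>i. i \<in> I \<Longrightarrow> small (A i)"
  shows "small (\<Union>i\<in>I. A i)"
proof (cases "I = {}")
  case False
  have "small (\<Union>n. A (from_nat_into I n))"
    using False assms(2) by (intro small_UN_nat) (auto intro: from_nat_into)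
  also have "(\<Union>n. A (from_nat_into I n)) = (\<Union>i\<in>range (from_nat_into I). A i)"
    by simp
  also have "range (from_nat_into I) = I"
    using False assms(1) by (rule range_from_nat_into)
  finally show ?thesis .
qed (simp add: small_empty)

lemma small_Un: "small A \<Longrightarrow> small B \<Longrightarrow> small (A \<union> B)"
  using small_UN[of "{A, B}" id] by auto

lemma accumI: "(\<And>U. open U \<Longrightarrow> p x \<in> U \<Longrightarrow> \<not> small (A \<inter> p -` U)) \<Longrightarrow> x \<in> accum A"
  by (simp add: accum_def)

lemma accumD: "x \<in> accum A \<Longrightarrow> open U \<Longrightarrow> p x \<in> U \<Longrightarrow> \<not> small (A \<inter> p -` U)"
  by (simp add: accum_def)

lemma not_accumE:
  assumes "x \<notin> accum A"
  obtains U where "open U" "p x \<in> U" "small (A \<inter> p -` U)"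
  using accumI[of x A] assms by metis

lemma accum_mono:
  assumes "A \<subseteq> B"
  shows "accum A \<subseteq> accum B"
proof
  fix x assume x: "x \<in> accum A"
  show "x \<in> accum B"
  proof (rule accumI)
    fix U assume "open U" "p x \<in> U"
    then have "\<not> small (A \<inter> p -` U)" by (rule accumD[OF x])
    moreover have "A \<inter> p -` U \<subseteq> B \<inter> p -` U" using assms by blast
    ultimately show "\<not> small (B \<inter> p -` U)" using small_mono by metis
  qed
qed

text \<open>Two neighbourhoods with small traces can be intersected, since a union of two small sets
  is small. This is what lets a chain survive splitting.\<close>

lemma accum_Un: "accum (A \<union> B) = accum A \<union> accum B"
proof
  show "accum (A \<union> B) \<subseteq> accum A \<union> accum B"
  proof (rule subsetI, rule ccontr)
    fix x assume x: "x \<in> accum (A \<union> B)" "x \<notin> accum A \<union> accum B"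
    obtain U where U: "open U" "p x \<in> U" "small (A \<inter> p -` U)"
      using x(2) not_accumE[of x A] by auto
    obtain V where V: "open V" "p x \<in> V" "small (B \<inter> p -` V)"
      using x(2) not_accumE[of x B] by auto
    have "small ((A \<union> B) \<inter> p -` (U \<inter> V))"
      by (rule small_mono[OF small_Un[OF U(3) V(3)]]) auto
    then show False using accumD[OF x(1), of "U \<inter> V"] U V by auto
  qed
qed (simp add: accum_mono)

lemma accum_Int_open:
  assumes "open U"
  shows "accum A \<inter> p -` U \<subseteq> accum (A \<inter> p -` U)"
proof
  fix x assume x: "x \<in> accum A \<inter> p -` U"
  show "x \<in> accum (A \<inter> p -` U)"
  proof (rule accumI)
    fix V assume "open V" "p x \<in> V"
    then have "\<not> small (A \<inter> p -` (U \<inter> V))"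
      using x assms by (intro accumD[of x]) auto
    then show "\<not> small (A \<inter> p -` U \<inter> p -` V)" by (simp add: Int_assoc)
  qed
qed

lemma not_small_if_accum: "x \<in> accum A \<Longrightarrow> \<not> small A"
  using accumD[of x A UNIV] by simp

lemma separated_mono:
  "separated h A B \<Longrightarrow> A' \<subseteq> A \<Longrightarrow> B' \<subseteq> B \<Longrightarrow> h \<le> h' \<Longrightarrow> separated h' A' B'"
  unfolding separated_def by (meson in_mono order_less_le_trans)

lemma separated_sym: "separated h A B \<Longrightarrow> separated h B A"
  unfolding separated_def by metis

text \<open>Otherwise discarding countably many small sets makes every coordinate of \<open>f\<close> locally
  constant.\<close>

lemma ex_accum_jump:
  assumes "\<not> small A"
  obtains k t where "\<not> small (A \<inter> {x. F x k = t} \<inter> accum (A \<inter> {x. F x k \<noteq> t}))"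
proof (rule ccontr)
  assume neg: "\<not> thesis"
  obtain \<B> :: "'a set set" where \<B>: "countable \<B>" "topological_basis \<B>"
    using ex_countable_basis by blast
  define E where "E k t = A \<inter> {x. F x k = t} \<inter> accum (A \<inter> {x. F x k \<noteq> t})" for k t
  \<comment> \<open>Basis sets are used so that only countably many small sets are
    discarded.\<close>
  define I where "I = {(U, k, t). U \<in> \<B> \<and> small (A \<inter> {x. F x k \<noteq> t} \<inter> p -` U)}"
  define E' where "E' = (\<lambda>(U, k, t). A \<inter> {x. F x k \<noteq> t} \<inter> p -` U)"
  have "small (\<Union>(k, t)\<in>UNIV. E k t)"
    using neg that by (intro small_UN) (auto simp: E_def)
  moreover have "small (\<Union>i\<in>I. E' i)"
  proof (rule small_UN)
    have "I \<subseteq> \<B> \<times> UNIV" by (auto simp: I_def)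
    then show "countable I" using \<B>(1) by (meson countable_SIGMA countableI_type countable_subset)
  qed (auto simp: I_def E'_def)
  moreover define A' where "A' = A - (\<Union>(k, t)\<in>UNIV. E k t) - (\<Union>i\<in>I. E' i)"
  have "small A'"
  proof (rule small_if_continuous, rule continuous_on_coordinatewise_then_product)
    fix k
    show "continuous_on (p ` A') (\<lambda>a. f a k)"
      unfolding continuous_on_topological
    proof (intro ballI allI impI)
      fix a B assume "a \<in> p ` A'" "open B" "f a k \<in> B"
      then obtain x where x: "x \<in> A'" "a = p x" by blast
      have "x \<notin> accum (A \<inter> {y. F y k \<noteq> F x k})"
        using x(1) by (auto simp: A'_def E_def)
      then obtain V where V: "open V" "p x \<in> V" "small (A \<inter> {y. F y k \<noteq> F x k} \<inter> p -` V)"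
        by (rule not_accumE)
      then obtain U where U: "U \<in> \<B>" "p x \<in> U" "U \<subseteq> V"
        using \<B>(2) by (meson topological_basisE)
      then have "small (A \<inter> {y. F y k \<noteq> F x k} \<inter> p -` U)"
        by (intro small_mono[OF V(3)]) auto
      then have "(U, k, F x k) \<in> I"
        using U(1) by (simp add: I_def)
      then have "F y k = F x k" if "y \<in> A'" "p y \<in> U" for y
        using that by (auto simp: A'_def E'_def)
      then have "\<forall>b\<in>p ` A'. b \<in> U \<longrightarrow> f b k \<in> B"
        using \<open>f a k \<in> B\<close> x(2) by (auto simp: F_def)
      then show "\<exists>U. open U \<and> a \<in> U \<and> (\<forall>b\<in>p ` A'. b \<in> U \<longrightarrow> f b k \<in> B)"
        using U(1,2) x(2) topological_basis_open[OF \<B>(2)] by blast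
    qed
  qed
  ultimately have "small ((\<Union>(k, t)\<in>UNIV. E k t) \<union> (\<Union>i\<in>I. E' i) \<union> A')"
    by (intro small_Un)
  then have "small A" by (rule small_mono) (auto simp: A'_def)
  then show False using assms by simp
qed

text \<open>The set found by \<open>ex_accum_jump\<close> is nonempty, and any of its points
  witnesses that the points with the other values are not small.\<close>

lemma ex_split:
  assumes "\<not> small A"
  obtains k t where "\<not> small (A \<inter> {x. F x k = t})" "\<not> small (A \<inter> {x. F x k \<noteq> t})"
proof -
  obtain k t where kt: "\<not> small (A \<inter> {x. F x k = t} \<inter> accum (A \<inter> {x. F x k \<noteq> t}))"
    using ex_accum_jump[OF assms] .
  then have "\<not> small (A \<inter> {x. F x k = t})"
    by (rule contrapos_nn) (erule small_mono, blast)
  moreover have "\<not> small (A \<inter> {x. F x k \<noteq> t})"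
  proof -
    obtain x where "x \<in> A \<inter> {x. F x k = t} \<inter> accum (A \<inter> {x. F x k \<noteq> t})"
      using kt small_empty by (metis ex_in_conv)
    then show ?thesis by (intro not_small_if_accum[of x]) simp
  qed
  ultimately show ?thesis using that by blast
qed

text \<open>A jump provides the first set, the points with value other than \<open>t\<close>; the
  rest of the chain is built inside the jump set. There the coordinate is constantly
  \<open>t\<close>, which separates, and every point is accumulated by the first set.\<close>

lemma ex_separated_chain:
  assumes "\<not> small A"
  shows "\<exists>Z h. chain l Z \<and> (\<forall>j\<le>l. Z j \<subseteq> A) \<and>
    (\<forall>j\<le>l. \<forall>j'\<le>l. j \<noteq> j' \<longrightarrow> separated h (Z j) (Z j'))"
  using assms
proof (induction l arbitrary: A)
  case 0
  then show ?case by (intro exI[of _ "\<lambda>_. A"]) (auto simp: chain_def)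
next
  case (Suc l)
  obtain k t where kt: "\<not> small (A \<inter> {x. F x k = t} \<inter> accum (A \<inter> {x. F x k \<noteq> t}))"
    (is "\<not> small ?B") using ex_accum_jump[OF Suc.prems] .
  obtain Z h where Z: "chain l Z" "\<And>j. j \<le> l \<Longrightarrow> Z j \<subseteq> ?B"
    "\<And>j j'. j \<le> l \<Longrightarrow> j' \<le> l \<Longrightarrow> j \<noteq> j' \<Longrightarrow> separated h (Z j) (Z j')"
    using Suc.IH[OF kt] by metis
  define Z' where "Z' = case_nat (A \<inter> {x. F x k \<noteq> t}) Z"
  have Z'[simp]: "Z' 0 = A \<inter> {x. F x k \<noteq> t}" "Z' (Suc j) = Z j" for j
    by (auto simp: Z'_def)
  define h' where "h' = max h (Suc k)"
  have "separated (Suc k) (Z' 0) ?B"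
    by (auto simp: separated_def)
  then have sep0: "separated h' (Z' 0) (Z j)" if "j \<le> l" for j
    by (rule separated_mono[OF _ order_refl Z(2)[OF that]]) (auto simp: h'_def)
  have "separated h' (Z' j) (Z' j')" if "j \<le> Suc l" "j' \<le> Suc l" "j \<noteq> j'" for j j'
  proof (cases j; cases j')
    fix i i' assume "j = Suc i" "j' = Suc i'"
    then show ?thesis
      using separated_mono[OF Z(3)[of i i'] order_refl order_refl, of h'] that by (simp add: h'_def)
  qed (use that sep0 separated_sym in auto)
  moreover have "chain (Suc l) Z'"
    unfolding chain_def
  proof (intro conjI allI impI)
    fix j assume "j < Suc l"
    then show "Z' (Suc j) \<subseteq> accum (Z' j)"
      using Z(1) Z(2)[of 0] by (cases j) (auto simp: chain_def)
  qed (use Z(1) in \<open>simp add: chain_def\<close>)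
  moreover have "Z' j \<subseteq> A" if "j \<le> Suc l" for j
    using Z(2) that by (cases j) auto
  ultimately show ?case by blast
qed

section \<open>Operations on chains\<close>

lemma chain_not_small:
  assumes "chain m Y" "i \<le> m"
  shows "\<not> small (Y i)"
proof (cases "i = m")
  case False
  \<comment> \<open>Backwards from the last set: a set that is not small has a point, and this point
    witnesses that the preceding set is not small.\<close>
  have "\<not> small (Y (m - k))" if "k \<le> m" for k
    using that
  proof (induction k)
    case (Suc k)
    then obtain x where "x \<in> Y (m - k)" using small_empty by (metis Suc_leD equals0I)
    moreover have "m - k = Suc (m - Suc k)" using Suc.prems by simp
    ultimately have "x \<in> accum (Y (m - Suc k))"
      using assms(1) Suc.prems unfolding chain_def by (metis diff_Suc_less less_le_trans subsetD zero_less_Suc)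
    then show ?case by (rule not_small_if_accum)
  qed (use assms in \<open>simp add: chain_def\<close>)
  then show ?thesis using assms(2) by (metis diff_diff_cancel diff_le_self)
qed (use assms in \<open>simp add: chain_def\<close>)

lemma chain_take: "chain m Y \<Longrightarrow> i \<le> m \<Longrightarrow> chain i Y"
  using chain_not_small[of m Y i] by (auto simp: chain_def)

text \<open>Cutting \<open>Y i\<close> may destroy accumulation at later sets, so each later set
  keeps only the points still accumulated by its cut predecessor. Accumulation from earlier sets
  passes to subsets, so these can stay.\<close>

primrec restrict :: "(nat \<Rightarrow> (nat \<Rightarrow> nat) set) \<Rightarrow> nat \<Rightarrow> (nat \<Rightarrow> nat) set \<Rightarrow> nat \<Rightarrow> (nat \<Rightarrow> nat) set" where
  "restrict Y i Q 0 = (if i = 0 then Y 0 \<inter> Q else Y 0)"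
| "restrict Y i Q (Suc j) =
    (if Suc j < i then Y (Suc j) else if Suc j = i then Y (Suc j) \<inter> Q
     else Y (Suc j) \<inter> accum (restrict Y i Q j))"

lemma restrict_below: "j < i \<Longrightarrow> restrict Y i Q j = Y j"
  by (cases j) auto

lemma restrict_at: "restrict Y i Q i = Y i \<inter> Q"
  by (cases i) auto

lemma restrict_subset: "restrict Y i Q j \<subseteq> Y j"
  by (cases j) auto

text \<open>As \<open>accum\<close> distributes over unions, no point is lost by both cuts. At
  \<open>j = m\<close> it follows that one of the cuts leaves a last set that is not small.\<close>

lemma restrict_Un:
  assumes "chain m Y" "j \<le> m" "i \<le> j"
  shows "Y j \<subseteq> restrict Y i Q j \<union> restrict Y i (- Q) j"
  using assms(3,2)
proof (induction j rule: dec_induct)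
  case base
  show ?case by (auto simp: restrict_at)
next
  case (step j)
  have "Y (Suc j) \<subseteq> accum (Y j)" using assms(1) step.prems by (simp add: chain_def)
  also have "\<dots> \<subseteq> accum (restrict Y i Q j) \<union> accum (restrict Y i (- Q) j)"
    using step accum_mono accum_Un by (metis Suc_leD)
  finally show ?case using step(1) by auto
qed

lemma chain_restrict:
  assumes "chain m Y" "i \<le> m" "\<not> small (restrict Y i Q m)"
  shows "chain m (restrict Y i Q)"
  unfolding chain_def
proof (intro conjI allI impI)
  fix j assume "j < m"
  then have Y: "Y (Suc j) \<subseteq> accum (Y j)" using assms(1) by (simp add: chain_def)
  show "restrict Y i Q (Suc j) \<subseteq> accum (restrict Y i Q j)"
  proof (cases "j < i")
    case True
    then show ?thesis using Y restrict_subset[of Y i Q "Suc j"] by (simp add: restrict_below del: restrict.simps)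
  qed auto
qed fact

lemma chain_split:
  assumes "chain m Y" "i \<le> m"
  obtains Z where "chain m Z" "\<And>j. Z j \<subseteq> Y j" "Z i \<subseteq> Q \<or> Z i \<subseteq> - Q"
proof -
  have "\<not> small (Y m)" using assms(1) by (simp add: chain_def)
  then have "\<not> small (restrict Y i Q m) \<or> \<not> small (restrict Y i (- Q) m)"
    using small_mono[OF small_Un restrict_Un[OF assms(1) order_refl assms(2), of Q]] by metis
  then show ?thesis
    using that[of "restrict Y i Q"] that[of "restrict Y i (- Q)"] chain_restrict[OF assms]
      restrict_subset restrict_at by (metis inf_le2)
qed

text \<open>One coordinate test serves both chains. Neither of its outcomes is small on
  \<open>Y m\<close>, so once \<open>chain_split\<close> has decided the outcome on
  \<open>Z i\<close>, the opposite one can be kept on \<open>Y m\<close>.\<close>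

lemma separate_last:
  assumes "chain m Y" "chain m' Y'" "i \<le> m'"
  obtains A Z h where "chain m (Y(m := A))" "A \<subseteq> Y m" "chain m' Z" "\<And>j. Z j \<subseteq> Y' j"
    "separated h A (Z i)"
proof -
  obtain k t where kt: "\<not> small (Y m \<inter> {x. F x k = t})" "\<not> small (Y m \<inter> {x. F x k \<noteq> t})"
    using ex_split assms(1) unfolding chain_def by metis
  obtain Z where Z: "chain m' Z" "\<And>j. Z j \<subseteq> Y' j" "Z i \<subseteq> {x. F x k = t} \<or> Z i \<subseteq> - {x. F x k = t}"
    using chain_split[OF assms(2,3)] by metis
  define A where "A = Y m \<inter> (if Z i \<subseteq> {x. F x k = t} then {x. F x k \<noteq> t} else {x. F x k = t})"
  have "chain m (Y(m := A))"
    using assms(1) kt by (auto simp: chain_def A_def)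
  moreover have "separated (Suc k) A (Z i)"
    using Z(3) by (auto simp: separated_def A_def)
  ultimately show ?thesis
    using that[of A Z "Suc k"] Z by (auto simp: A_def)
qed

text \<open>The finitely many pairs are treated in turn by \<open>separate_last\<close>; sets only
  shrink, so separations obtained before persist. Pairs in which neither set is the last of its
  chain are left to the previous stage, see \<open>stage_Suc\<close>.\<close>

lemma separate_family:
  assumes "finite U" and chains: "\<And>u. u \<in> U \<Longrightarrow> chain (m u) (Y u)"
  obtains Y' h where "\<And>u. u \<in> U \<Longrightarrow> chain (m u) (Y' u)" "\<And>u j. Y' u j \<subseteq> Y u j"
    "\<And>u u' i. u \<in> U \<Longrightarrow> u' \<in> U \<Longrightarrow> u \<noteq> u' \<Longrightarrow> i \<le> m u' \<Longrightarrow> separated h (Y' u (m u)) (Y' u' i)"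
proof -
  define T where "T = {(u, u', i). u \<in> U \<and> u' \<in> U \<and> u \<noteq> u' \<and> i \<le> m u'}"
  have "T \<subseteq> U \<times> (SIGMA u':U. {..m u'})" by (auto simp: T_def)
  then have "finite T" by (rule finite_subset) (use assms(1) in auto)
  have "\<exists>Y' h. (\<forall>u\<in>U. chain (m u) (Y' u)) \<and> (\<forall>u j. Y' u j \<subseteq> Y u j) \<and>
      (\<forall>(u, u', i)\<in>S. separated h (Y' u (m u)) (Y' u' i))" if "S \<subseteq> T" for S
    using finite_subset[OF that \<open>finite T\<close>] that
  proof (induction S)
    case empty
    then show ?case using chains by (intro exI[of _ Y]) auto
  next
    case (insert q S)
    obtain u u' i where q: "q = (u, u', i)" "u \<in> U" "u' \<in> U" "u \<noteq> u'" "i \<le> m u'"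
      using insert.prems by (auto simp: T_def)
    obtain Y' h where Y': "\<And>u. u \<in> U \<Longrightarrow> chain (m u) (Y' u)" "\<And>u j. Y' u j \<subseteq> Y u j"
      "\<And>u u' i. (u, u', i) \<in> S \<Longrightarrow> separated h (Y' u (m u)) (Y' u' i)"
      using insert by fastforce
    obtain A Z h' where AZ: "chain (m u) ((Y' u)(m u := A))" "A \<subseteq> Y' u (m u)" "chain (m u') Z"
      "\<And>j. Z j \<subseteq> Y' u' j" "separated h' A (Z i)"
      using separate_last[OF Y'(1)[OF q(2)] Y'(1)[OF q(3)] q(5)] by metis
    define Y'' where "Y'' = Y'(u := (Y' u)(m u := A), u' := Z)"
    have sub: "Y'' v j \<subseteq> Y' v j" for v j
      using AZ by (auto simp: Y''_def)
    have "\<forall>v\<in>U. chain (m v) (Y'' v)"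
      using Y'(1) AZ by (auto simp: Y''_def)
    moreover have "\<forall>v j. Y'' v j \<subseteq> Y v j"
      using sub Y'(2) by (meson order_trans)
    moreover have "\<forall>(v, v', j)\<in>insert q S. separated (max h h') (Y'' v (m v)) (Y'' v' j)"
    proof -
      have "separated (max h h') (Y'' u (m u)) (Y'' u' i)"
        using separated_mono[OF AZ(5)] q(4) by (auto simp: Y''_def)
      moreover have "separated (max h h') (Y'' v (m v)) (Y'' v' j)" if "(v, v', j) \<in> S" for v v' j
        using separated_mono[OF Y'(3)[OF that] sub sub] by simp
      ultimately show ?thesis using q(1) by auto
    qed
    ultimately show ?case by blast
  qed
  from this[OF order_refl] obtain Y' h where *: "\<forall>u\<in>U. chain (m u) (Y' u)" "\<forall>u j. Y' u j \<subseteq> Y u j"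
      "\<forall>(u, u', i)\<in>T. separated h (Y' u (m u)) (Y' u' i)" by blast
  show ?thesis by (rule that[of Y' h]) (use * in \<open>auto simp: T_def\<close>)
qed

end

section \<open>The fusion\<close>

definition trunc :: "nat \<Rightarrow> (nat \<Rightarrow> enat) \<Rightarrow> nat \<Rightarrow> enat" where
  "trunc n y = (\<lambda>i. if i < n \<and> y i < enat n then y i else \<infinity>)"

text \<open>The first index at which the step from \<open>trunc n y\<close> to
  \<open>trunc (Suc n) y\<close> may reveal something: either an entry \<open>n\<close> becomes
  visible there, or the index \<open>n\<close> itself comes into range.\<close>

definition fresh :: "nat \<Rightarrow> (nat \<Rightarrow> enat) \<Rightarrow> nat" where
  "fresh n y = (LEAST i. i = n \<or> y i = enat n)"

lemma trunc_trunc: "n \<le> m \<Longrightarrow> trunc n (trunc m y) = trunc n y"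
  by (force simp: trunc_def fun_eq_iff intro: less_le_trans)

lemma finite_range_trunc: "finite (range (trunc n))"
proof (rule finite_subset)
  let ?S = "insert \<infinity> (enat ` {..<n})"
  show "range (trunc n) \<subseteq> {v. \<forall>i. (i \<in> {..<n} \<longrightarrow> v i \<in> ?S) \<and> (i \<notin> {..<n} \<longrightarrow> v i = \<infinity>)}"
    by (auto simp: trunc_def elim!: less_enatE)
  show "finite {v. \<forall>i. (i \<in> {..<n} \<longrightarrow> v i \<in> ?S) \<and> (i \<notin> {..<n} \<longrightarrow> v i = \<infinity>)}"
    by (rule finite_set_of_finite_funs) auto
qed

lemma fresh_le: "fresh n y \<le> n"
  unfolding fresh_def by (rule Least_le) simp

lemma fresh_cases: "fresh n y = n \<or> y (fresh n y) = enat n"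
  unfolding fresh_def by (rule LeastI[of _ n]) simp

lemma fresh_le_if: "y i = enat n \<Longrightarrow> fresh n y \<le> i"
  unfolding fresh_def by (rule Least_le) simp

lemma less_fresh: "i < fresh n y \<Longrightarrow> i < n \<and> y i \<noteq> enat n"
  using fresh_le[of n y] fresh_le_if[of y i n] by force

lemma fresh_trunc: "fresh n (trunc (Suc n) y) = fresh n y"
proof -
  have "trunc (Suc n) y i = enat n \<longleftrightarrow> y i = enat n" if "i \<le> n" for i
    using that by (auto simp: trunc_def)
  then have "fresh n y \<le> fresh n (trunc (Suc n) y)" "fresh n (trunc (Suc n) y) \<le> fresh n y"
    using fresh_cases[of n y] fresh_cases[of n "trunc (Suc n) y"] fresh_le[of n y]
      fresh_le[of n "trunc (Suc n) y"] fresh_le_if by metis+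
  then show ?thesis by simp
qed

lemma trunc_less_fresh:
  assumes "u \<in> range (trunc (Suc n))" "i < fresh n u"
  shows "trunc n u i = u i"
proof -
  have "i < n" "u i \<noteq> enat n" using less_fresh[OF assms(2)] by auto
  moreover have "u i = \<infinity> \<or> u i < enat (Suc n)" using assms(1) by (auto simp: trunc_def)
  ultimately show ?thesis by (cases "u i") (auto simp: trunc_def)
qed

section \<open>One step of the fusion\<close>

context continuous_lift
begin

text \<open>Countably many pieces, given by a basis set of small diameter and the first
  \<open>l\<close> coordinates, cover \<open>Y m\<close>, so one of them is not small. The earlier
  sets are cut only by the basis set: accumulation respects open sets of \<open>'a\<close>, but not
  coordinates of the Baire space.\<close>

lemma localize:
  assumes "chain m Y" "e > 0"
  obtains Y' where "chain m Y'" "\<And>j. Y' j \<subseteq> Y j"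
    "\<And>i j a b. a \<in> Y' i \<Longrightarrow> b \<in> Y' j \<Longrightarrow> dist (p a) (p b) < e"
    "\<And>a b k. a \<in> Y' m \<Longrightarrow> b \<in> Y' m \<Longrightarrow> k < l \<Longrightarrow> a k = b k"
proof -
  obtain \<B> :: "'a set set" where \<B>: "countable \<B>" "topological_basis \<B>"
    using ex_countable_basis by blast
  define I where "I = {B \<in> \<B>. \<forall>a\<in>B. \<forall>b\<in>B. dist a b < e} \<times> (UNIV :: nat list set)"
  define G where "G = (\<lambda>(B, s). Y m \<inter> p -` B \<inter> {a. map a [0..<l] = s})"
  have "countable I" unfolding I_def using \<B>(1) by (intro countable_SIGMA) auto
  moreover have "Y m \<subseteq> (\<Union>i\<in>I. G i)"
  proof
    fix x assume x: "x \<in> Y m"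
    obtain B where B: "B \<in> \<B>" "p x \<in> B" "B \<subseteq> ball (p x) (e/2)"
      using \<B>(2) assms(2) by (meson centre_in_ball half_gt_zero open_ball topological_basisE)
    have "dist a b < e" if "a \<in> B" "b \<in> B" for a b
    proof -
      have "dist (p x) a < e/2" "dist (p x) b < e/2" using B(3) that by auto
      then show ?thesis using dist_triangle3[of a b "p x"] by simp
    qed
    then have "(B, map x [0..<l]) \<in> I" using B(1) by (simp add: I_def)
    moreover have "x \<in> G (B, map x [0..<l])" using x B(2) by (simp add: G_def)
    ultimately show "x \<in> (\<Union>i\<in>I. G i)" by blast
  qed
  moreover have "\<not> small (Y m)" using assms(1) by (simp add: chain_def)
  ultimately obtain i where i: "i \<in> I" "\<not> small (G i)"
    using small_UN[of I G] small_mono by metis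
  obtain B s where Bs: "i = (B, s)" by (cases i)
  have B: "B \<in> \<B>" "\<And>a b. a \<in> B \<Longrightarrow> b \<in> B \<Longrightarrow> dist a b < e"
    using i(1) by (auto simp: I_def Bs)
  have "open B" using B(1) \<B>(2) by (rule topological_basis_open[rotated])
  define Y' where "Y' j = (if j = m then G i else Y j \<inter> p -` B)" for j
  have sub: "Y' j \<subseteq> Y j \<inter> p -` B" for j by (auto simp: Y'_def G_def Bs)
  show ?thesis
  proof (rule that[of Y'])
    show "chain m Y'"
      unfolding chain_def
    proof (intro conjI allI impI)
      fix j assume "j < m"
      then have "Y' (Suc j) \<subseteq> accum (Y j) \<inter> p -` B"
        using sub[of "Suc j"] assms(1) by (auto simp: chain_def)
      also have "\<dots> \<subseteq> accum (Y' j)"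
        using accum_Int_open[OF \<open>open B\<close>] \<open>j < m\<close> by (simp add: Y'_def)
      finally show "Y' (Suc j) \<subseteq> accum (Y' j)" .
    qed (use i in \<open>simp add: Y'_def\<close>)
    show "Y' j \<subseteq> Y j" for j using sub by blast
    show "dist (p a) (p b) < e" if "a \<in> Y' i" "b \<in> Y' j" for i j a b
      using sub that B(2) by (metis Int_iff subsetD vimageD)
    show "a k = b k" if "a \<in> Y' m" "b \<in> Y' m" "k < l" for a b k
    proof -
      have "map a [0..<l] = map b [0..<l]" using that by (simp add: Y'_def G_def Bs)
      then show ?thesis using that(3) by simp
    qed
  qed
qed

text \<open>In \<open>v \<in> range (trunc n)\<close> an entry \<open>\<infinity>\<close> stands for anything not below \<open>n\<close>. The set \<open>X v n\<close> is
  to contain the images of the \<open>y\<close> that agree with \<open>v\<close> below \<open>n\<close>. If \<open>v i = \<infinity>\<close>, then \<open>X v i\<close> is to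
  contain the images of the \<open>y\<close> that truncate to \<open>v\<close>, agree with \<open>v\<close> below \<open>i\<close> and have a finite
  entry at \<open>i\<close>. If \<open>v i\<close> is finite, then \<open>X v i\<close> is a dummy.\<close>

definition stage :: "nat \<Rightarrow> ((nat \<Rightarrow> enat) \<Rightarrow> nat \<Rightarrow> (nat \<Rightarrow> nat) set) \<Rightarrow> nat \<Rightarrow> bool" where
  "stage n X h \<longleftrightarrow> (\<forall>v\<in>range (trunc n). chain n (X v)) \<and>
    (\<forall>v\<in>range (trunc n). \<forall>v'\<in>range (trunc n). \<forall>i\<le>n. \<forall>i'\<le>n.
      (i < n \<longrightarrow> v i = \<infinity>) \<longrightarrow> (i' < n \<longrightarrow> v' i' = \<infinity>) \<longrightarrow> \<not> (i = i' \<and> (\<forall>j<i. v j = v' j)) \<longrightarrow>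
      separated h (X v i) (X v' i'))"

text \<open>If \<open>fresh n u < n\<close>, the entry of \<open>u\<close> at \<open>fresh n u\<close> is no longer \<open>\<infinity>\<close>: the sets of \<open>u\<close> from this
  index on are cut out anew from the set reserved at this index.\<close>

definition refines :: "nat \<Rightarrow> ((nat \<Rightarrow> enat) \<Rightarrow> nat \<Rightarrow> (nat \<Rightarrow> nat) set) \<Rightarrow>
    ((nat \<Rightarrow> enat) \<Rightarrow> nat \<Rightarrow> (nat \<Rightarrow> nat) set) \<Rightarrow> bool" where
  "refines n X X' \<longleftrightarrow> (\<forall>u\<in>range (trunc (Suc n)).
    (\<forall>i\<le>Suc n. X' u i \<subseteq> X (trunc n u) (min i (fresh n u))) \<and>
    (\<forall>i\<le>Suc n. \<forall>j\<le>Suc n. fresh n u \<le> i \<longrightarrow> fresh n u \<le> j \<longrightarrow>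
      (\<forall>a\<in>X' u i. \<forall>b\<in>X' u j. \<forall>k\<le>n. a k = b k)) \<and>
    (\<forall>i\<le>Suc n. \<forall>j\<le>Suc n. \<forall>a\<in>X' u i. \<forall>b\<in>X' u j. dist (p a) (p b) < (1/2)^n))"

lemma stage_chain: "stage n X h \<Longrightarrow> v \<in> range (trunc n) \<Longrightarrow> chain n (X v)"
  unfolding stage_def by blast

lemma stage_separated:
  assumes "stage n X h" "v \<in> range (trunc n)" "v' \<in> range (trunc n)" "i \<le> n" "i' \<le> n"
    "i < n \<Longrightarrow> v i = \<infinity>" "i' < n \<Longrightarrow> v' i' = \<infinity>" "\<not> (i = i' \<and> (\<forall>j<i. v j = v' j))"
  shows "separated h (X v i) (X v' i')"
  using assms unfolding stage_def by blast

lemma stage_0: "stage 0 (\<lambda>_ _. UNIV) 0"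
  using not_small_UNIV by (simp add: stage_def chain_def)

text \<open>For each new truncation \<open>u\<close> the old chain is taken up to index
  \<open>fresh n u\<close>, localised, and separated from the other chains. A separated chain inside
  its last set then supplies the sets for the remaining indices.\<close>

lemma stage_Suc:
  assumes X: "stage n X h"
  shows "\<exists>X' h'. stage (Suc n) X' h' \<and> refines n X X'"
proof -
  define U where "U = range (trunc (Suc n))"
  define m where "m = fresh n"
  have m: "m u \<le> n" for u by (simp add: m_def fresh_le)
  have "\<forall>u. \<exists>Y. chain (m u) Y \<and> (\<forall>j. Y j \<subseteq> X (trunc n u) j) \<and>
      (\<forall>i j. \<forall>a\<in>Y i. \<forall>b\<in>Y j. dist (p a) (p b) < (1/2)^n) \<and>
      (\<forall>a\<in>Y (m u). \<forall>b\<in>Y (m u). \<forall>k\<le>n. a k = b k)" (is "\<forall>u. \<exists>Y. ?P u Y")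
  proof
    fix u
    show "\<exists>Y. ?P u Y"
  proof -
    have "chain (m u) (X (trunc n u))"
      by (rule chain_take[OF stage_chain[OF X] m]) (rule rangeI)
    then obtain Y where "chain (m u) Y" "\<And>j. Y j \<subseteq> X (trunc n u) j"
      "\<And>i j a b. a \<in> Y i \<Longrightarrow> b \<in> Y j \<Longrightarrow> dist (p a) (p b) < (1/2)^n"
      "\<And>a b k. a \<in> Y (m u) \<Longrightarrow> b \<in> Y (m u) \<Longrightarrow> k < Suc n \<Longrightarrow> a k = b k"
      by (rule localize[where e = "(1/2)^n" and l = "Suc n"]) auto
    then show ?thesis by (intro exI[of _ Y]) (simp add: less_Suc_eq_le)
    qed
  qed
  from choice[OF this] obtain Y where "\<forall>u. ?P u (Y u)" ..
  then have Y: "\<And>u. chain (m u) (Y u)" "\<And>u j. Y u j \<subseteq> X (trunc n u) j"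
      "\<And>u i j a b. a \<in> Y u i \<Longrightarrow> b \<in> Y u j \<Longrightarrow> dist (p a) (p b) < (1/2)^n"
      "\<And>u a b k. a \<in> Y u (m u) \<Longrightarrow> b \<in> Y u (m u) \<Longrightarrow> k \<le> n \<Longrightarrow> a k = b k"
    by auto
  have "finite U" unfolding U_def by (rule finite_range_trunc)
  then obtain Y' h1 where Y': "\<And>u. u \<in> U \<Longrightarrow> chain (m u) (Y' u)" "\<And>u j. Y' u j \<subseteq> Y u j"
    "\<And>u u' i. u \<in> U \<Longrightarrow> u' \<in> U \<Longrightarrow> u \<noteq> u' \<Longrightarrow> i \<le> m u' \<Longrightarrow> separated h1 (Y' u (m u)) (Y' u' i)"
    using separate_family[of U m Y, OF _ Y(1)] by metis
  have "\<forall>u\<in>U. \<exists>Zg. chain (Suc n - m u) (fst Zg) \<and> (\<forall>j\<le>Suc n - m u. fst Zg j \<subseteq> Y' u (m u)) \<and>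
    (\<forall>j\<le>Suc n - m u. \<forall>j'\<le>Suc n - m u. j \<noteq> j' \<longrightarrow> separated (snd Zg) (fst Zg j) (fst Zg j'))"
    (is "\<forall>u\<in>U. \<exists>Zg. ?P u Zg")
  proof
    fix u assume "u \<in> U"
    then have "\<not> small (Y' u (m u))" using Y'(1) by (simp add: chain_def)
    then obtain Z g where "?P u (Z, g)"
      using ex_separated_chain[of "Y' u (m u)" "Suc n - m u"] by auto
    then show "\<exists>Zg. ?P u Zg" ..
  qed
  from bchoice[OF this] obtain Zg where "\<forall>u\<in>U. ?P u (Zg u)" ..
  moreover define Z where "Z u = fst (Zg u)" for u
  moreover define g where "g u = snd (Zg u)" for u
  ultimately have Z: "\<And>u. u \<in> U \<Longrightarrow> chain (Suc n - m u) (Z u)"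
    "\<And>u j. u \<in> U \<Longrightarrow> j \<le> Suc n - m u \<Longrightarrow> Z u j \<subseteq> Y' u (m u)"
    "\<And>u j j'. u \<in> U \<Longrightarrow> j \<le> Suc n - m u \<Longrightarrow> j' \<le> Suc n - m u \<Longrightarrow> j \<noteq> j' \<Longrightarrow> separated (g u) (Z u j) (Z u j')"
    by auto
  \<comment> \<open>The shift attaches the new chain at \<open>m u\<close>; its length
    \<open>Suc n - m u\<close> makes \<open>Suc n\<close> the last index.\<close>
  define X' where "X' u i = (if i < m u then Y' u i else Z u (i - m u))" for u i
  define h' where "h' = h + h1 + sum g U"
  have g_le: "g u \<le> h'" if "u \<in> U" for u
    using member_le_sum[OF that _ \<open>finite U\<close>, of g] by (simp add: h'_def)
  have X'_Y': "X' u i \<subseteq> Y' u (min i (m u))" if "u \<in> U" "i \<le> Suc n" for u i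
  proof (cases "i < m u")
    case False
    then have "X' u i = Z u (i - m u)" "min i (m u) = m u" by (auto simp: X'_def)
    then show ?thesis using Z(2)[OF that(1), of "i - m u"] that(2) by simp
  qed (simp add: X'_def)
  have X'_X: "X' u i \<subseteq> X (trunc n u) (min i (m u))" if "u \<in> U" "i \<le> Suc n" for u i
    using X'_Y'[OF that] Y'(2) Y(2) by (meson order_trans)
  have "refines n X X'"
    unfolding refines_def U_def[symmetric] m_def[symmetric]
  proof (intro ballI conjI allI impI)
    fix u assume u: "u \<in> U"
    show "X' u i \<subseteq> X (trunc n u) (min i (m u))" if "i \<le> Suc n" for i
      using X'_X u that .
    show "a k = b k" if "i \<le> Suc n" "j \<le> Suc n" "m u \<le> i" "m u \<le> j" "a \<in> X' u i" "b \<in> X' u j" "k \<le> n"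
      for i j a b k
    proof -
      have "a \<in> Y u (m u)" "b \<in> Y u (m u)"
        using that X'_Y'[OF u, of i] X'_Y'[OF u, of j] Y'(2)[of u "m u"] by (auto simp: min_def split: if_splits)
      then show ?thesis using Y(4) that(7) by blast
    qed
    show "dist (p a) (p b) < (1/2)^n" if "i \<le> Suc n" "j \<le> Suc n" "a \<in> X' u i" "b \<in> X' u j" for i j a b
      using that X'_Y'[OF u] Y'(2) Y(3) by (meson subsetD)
  qed
  moreover have "stage (Suc n) X' h'"
    unfolding stage_def U_def[symmetric]
  proof (intro conjI ballI allI impI)
    fix u assume u: "u \<in> U"
    show "chain (Suc n) (X' u)"
      unfolding chain_def
    proof (intro conjI allI impI)
      show "\<not> small (X' u (Suc n))"
        using Z(1)[OF u] m[of u] by (simp add: chain_def X'_def)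
      fix j assume j: "j < Suc n"
      show "X' u (Suc j) \<subseteq> accum (X' u j)"
      proof (cases "j < m u")
        \<comment> \<open>At the junction \<open>Suc j = m u\<close>, the set \<open>Z u 0\<close>
          lies in \<open>Y' u (m u)\<close> and is therefore accumulated by the preceding
          set.\<close>
        case True
        then have "X' u (Suc j) \<subseteq> Y' u (Suc j)"
          using X'_Y'[OF u, of "Suc j"] j by (simp add: min_def)
        also have "\<dots> \<subseteq> accum (Y' u j)"
          using Y'(1)[OF u] True by (simp add: chain_def)
        finally show ?thesis using True by (simp add: X'_def)
      next
        case False
        then have "Suc j - m u = Suc (j - m u)" "j - m u < Suc n - m u" using j by auto
        then show ?thesis using False Z(1)[OF u] by (simp add: chain_def X'_def)
      qed
    qed
  next
    fix u u' i i' assume u: "u \<in> U" and u': "u' \<in> U" and i: "i \<le> Suc n" "i < Suc n \<longrightarrow> u i = \<infinity>"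
      and i': "i' \<le> Suc n" "i' < Suc n \<longrightarrow> u' i' = \<infinity>"
      and neq: "\<not> (i = i' \<and> (\<forall>j<i. u j = u' j))"
    \<comment> \<open>The index used at stage \<open>n\<close> never denotes a dummy: if
      \<open>m v < n\<close>, the entry there is \<open>n\<close>, which \<open>trunc n\<close>
      still shows as \<open>\<infinity>\<close>.\<close>
    have real: "k < n \<longrightarrow> trunc n v k = \<infinity>" if "k = m v \<or> k \<le> m v \<and> v k = \<infinity>" for v k
      using that fresh_cases[of n v] by (auto simp: m_def trunc_def)
    have stage_n: "separated h' (X' u i) (X' u' i')"
      if "\<not> (min i (m u) = min i' (m u') \<and> (\<forall>j<min i (m u). trunc n u j = trunc n u' j))"
    proof (rule separated_mono)
      show "separated h (X (trunc n u) (min i (m u))) (X (trunc n u') (min i' (m u')))"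
      proof (rule stage_separated[OF X])
        show "trunc n u (min i (m u)) = \<infinity>" if "min i (m u) < n"
          using real[of "min i (m u)" u] that i m[of u] by (auto simp: min_def split: if_splits)
        show "trunc n u' (min i' (m u')) = \<infinity>" if "min i' (m u') < n"
          using real[of "min i' (m u')" u'] that i' m[of u'] by (auto simp: min_def split: if_splits)
      qed (use that m[of u] m[of u'] in auto)
    qed (use X'_X u u' i(1) i'(1) in \<open>auto simp: h'_def\<close>)
    show "separated h' (X' u i) (X' u' i')"
    proof (cases "u = u'")
      case True
      then have "i \<noteq> i'" using neq by auto
      show ?thesis
      proof (cases "m u \<le> i \<and> m u \<le> i'")
        case True
        then have "separated (g u) (Z u (i - m u)) (Z u (i' - m u))"
          using \<open>i \<noteq> i'\<close> i i' u by (intro Z(3)) auto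
        then have "separated h' (Z u (i - m u)) (Z u (i' - m u))"
          by (rule separated_mono) (auto intro: g_le u)
        then show ?thesis using True \<open>u = u'\<close> by (simp add: X'_def)
      next
        case False
        then show ?thesis using \<open>i \<noteq> i'\<close> \<open>u = u'\<close> by (intro stage_n) (auto simp: min_def)
      qed
    next
      case False
      \<comment> \<open>If one index has reached the new part of its chain,
        \<open>separate_family\<close> applies. Otherwise both lie where \<open>trunc n\<close>
        loses nothing, and the separation is inherited from stage \<open>n\<close>.\<close>
      consider "m u \<le> i" | "m u' \<le> i'" | "i < m u" "i' < m u'" by linarith
      then show ?thesis
      proof cases
        case 1
        then have "X' u i \<subseteq> Y' u (m u)" using X'_Y'[OF u i(1)] by (simp add: min_absorb2)
        then show ?thesis
          by (rule separated_mono[OF Y'(3)[OF u u' False min.cobounded2] _ X'_Y'[OF u' i'(1)]])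
            (simp add: h'_def)
      next
        case 2
        then have "X' u' i' \<subseteq> Y' u' (m u')" using X'_Y'[OF u' i'(1)] by (simp add: min_absorb2)
        then have "separated h' (X' u' i') (X' u i)"
          by (rule separated_mono[OF Y'(3)[OF u' u False[symmetric] min.cobounded2] _ X'_Y'[OF u i(1)]])
            (simp add: h'_def)
        then show ?thesis by (rule separated_sym)
      next
        case 3
        have "trunc n u j = u j" "trunc n u' j = u' j" if "i = i'" "j < i" for j
          using trunc_less_fresh[of u n j] trunc_less_fresh[of u' n j] u u' 3 that
          by (auto simp: U_def m_def)
        then show ?thesis using neq 3 by (intro stage_n) auto
      qed
    qed
  qed
  ultimately show ?thesis by blast
qed

lemma ex_stages:
  obtains X h where "\<forall>n. stage n (X n) (h n)" "\<forall>n. refines n (X n) (X (Suc n))"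
proof -
  have "\<exists>Xh. \<forall>n. case_prod (stage n) (Xh n) \<and> refines n (fst (Xh n)) (fst (Xh (Suc n)))"
  proof (rule dependent_nat_choice)
    show "\<exists>Xh. case_prod (stage 0) Xh"
      using stage_0 by (intro exI[of _ "(\<lambda>_ _. UNIV, 0)"]) simp
    show "\<exists>Xh'. case_prod (stage (Suc n)) Xh' \<and> refines n (fst Xh) (fst Xh')"
      if "case_prod (stage n) Xh" for Xh n
      using stage_Suc[of n "fst Xh" "snd Xh"] that by (auto simp: case_prod_beta)
  qed
  then obtain Xh where "\<forall>n. case_prod (stage n) (Xh n) \<and> refines n (fst (Xh n)) (fst (Xh (Suc n)))" ..
  then show ?thesis
    by (intro that[of "\<lambda>n. fst (Xh n)" "\<lambda>n. snd (Xh n)"]) (simp_all add: case_prod_beta)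
qed

end

section \<open>The limit map\<close>

lemma open_imp_agree:
  fixes x :: "nat \<Rightarrow> 'b::topological_space"
  assumes "open S" "x \<in> S"
  obtains l where "\<And>z. (\<And>k. k < l \<Longrightarrow> z k = x k) \<Longrightarrow> z \<in> S"
proof -
  have "openin (product_topology (\<lambda>_. euclidean) UNIV) S"
    using assms(1) by (simp add: euclidean_product_topology)
  from product_topology_open_contains_basis[OF this assms(2)]
  obtain X where X: "x \<in> (\<Pi>\<^sub>E i\<in>UNIV. X i)" "finite {i. X i \<noteq> topspace euclidean}"
    "(\<Pi>\<^sub>E i\<in>UNIV. X i) \<subseteq> S"
    by blast
  obtain l where l: "{i. X i \<noteq> topspace euclidean} \<subseteq> {..<l}"
    using X(2) finite_nat_bounded by blast
  have "z \<in> S" if "\<And>k. k < l \<Longrightarrow> z k = x k" for z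
  proof -
    have "z k \<in> X k" for k
    proof (cases "k < l")
      case True
      then show ?thesis using that X(1) by (auto simp: PiE_iff)
    next
      case False
      then have "X k = UNIV" using l by auto
      then show ?thesis by simp
    qed
    then show ?thesis using X(3) by (auto simp: PiE_iff)
  qed
  then show ?thesis by (rule that)
qed

lemma tendsto_if_eventually_agree:
  fixes c :: "nat \<Rightarrow> nat \<Rightarrow> 'b::topological_space"
  assumes "\<And>l. \<exists>N. \<forall>m\<ge>N. \<forall>k<l. c m k = x k"
  shows "c \<longlonglongrightarrow> x"
proof (rule topological_tendstoI)
  fix S assume "open S" "x \<in> S"
  then obtain l where l: "\<And>z. (\<And>k. k < l \<Longrightarrow> z k = x k) \<Longrightarrow> z \<in> S"
    using open_imp_agree by blast
  obtain N where "\<forall>m\<ge>N. \<forall>k<l. c m k = x k" using assms by blast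
  then show "\<forall>\<^sub>F m in sequentially. c m \<in> S"
    using l by (intro eventually_sequentiallyI[of N]) auto
qed

text \<open>The hypothesis \<open>det\<close> is continuity of the inverse written in coordinates;
  applied to every coordinate it also gives injectivity.\<close>

lemma embedding_map_if_determined:
  fixes \<psi> :: "(nat \<Rightarrow> nat) \<Rightarrow> nat \<Rightarrow> nat"
  assumes "continuous_on UNIV \<psi>"
    and det: "\<And>x l. \<exists>H. \<forall>x'. (\<forall>k<H. \<psi> x' k = \<psi> x k) \<longrightarrow> (\<forall>i<l. x' i = x i)"
  shows "embedding_map euclidean euclidean \<psi>"
proof -
  have "x' = x" if "\<psi> x' = \<psi> x" for x x'
  proof
    fix i
    obtain H where "\<forall>x'. (\<forall>k<H. \<psi> x' k = \<psi> x k) \<longrightarrow> (\<forall>j<Suc i. x' j = x j)" using det by blast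
    then show "x' i = x i" using that by simp
  qed
  then have "inj \<psi>" by (auto simp: inj_def)
  have "openin (top_of_set (range \<psi>)) (\<psi> ` S)" if "open S" for S
  proof (subst openin_subopen, rule ballI)
    fix z assume "z \<in> \<psi> ` S"
    then obtain x where x: "x \<in> S" "z = \<psi> x" by blast
    obtain l where l: "\<And>x'. (\<And>k. k < l \<Longrightarrow> x' k = x k) \<Longrightarrow> x' \<in> S"
      using open_imp_agree[OF \<open>open S\<close> x(1)] by blast
    obtain H where H: "\<And>x'. (\<forall>k<H. \<psi> x' k = \<psi> x k) \<Longrightarrow> (\<forall>i<l. x' i = x i)"
      using det by blast
    let ?T = "range \<psi> \<inter> {z'. \<forall>k<H. z' k = \<psi> x k}"
    have "openin (top_of_set (range \<psi>)) ?T"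
      by (intro openin_open_Int open_agree)
    moreover have "?T \<subseteq> \<psi> ` S"
    proof
      fix z' assume "z' \<in> ?T"
      then obtain x' where x': "z' = \<psi> x'" "\<forall>k<H. \<psi> x' k = \<psi> x k" by auto
      then have "x' \<in> S" using H[OF x'(2)] by (intro l) simp
      then show "z' \<in> \<psi> ` S" using x'(1) by blast
    qed
    ultimately show "\<exists>T. openin (top_of_set (range \<psi>)) T \<and> z \<in> T \<and> T \<subseteq> \<psi> ` S"
      using x(2) by (intro exI[of _ ?T]) auto
  qed
  then have "open_map euclidean (top_of_set (range \<psi>)) \<psi>"
    by (simp add: open_map_def)
  moreover have "continuous_map euclidean (top_of_set (range \<psi>)) \<psi>"
    using assms(1) by (simp add: continuous_map_in_subtopology)
  ultimately show ?thesis
    unfolding embedding_map_def using \<open>inj \<psi>\<close>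
    by (intro bijective_open_imp_homeomorphic_map) auto
qed

text \<open>A continuous injection of a compact space into a Hausdorff space is an embedding, so for
  the map into \<open>'a\<close> it remains to show continuity and injectivity.\<close>

lemma compact_space_enat_fun: "compact_space (euclidean :: (nat \<Rightarrow> enat) topology)"
proof -
  have "compact_space (euclidean :: enat topology)"
    using compact_UNIV by (simp add: compact_space_def)
  then have "compact_space (product_topology (\<lambda>_::nat. euclidean :: enat topology) UNIV)"
    by (simp add: compact_space_product_topology)
  then show ?thesis by (simp add: euclidean_product_topology)
qed

lemma open_trunc_eq: "open {y'. trunc n y' = trunc n y}"
proof -
  define E where "E i = {e. (if e < enat n then e else \<infinity>) = trunc n y i}" for i
  have fin: "finite {e. e < enat n}"
    by (rule finite_subset[of _ "enat ` {..<n}"]) (auto elim!: less_enatE)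
  have "open (E i)" for i
  proof (cases "trunc n y i < enat n")
    case True
    then obtain k where "trunc n y i = enat k" by (cases "trunc n y i") auto
    then have "E i = {enat k}" using True by (auto simp: E_def split: if_splits)
    then show ?thesis by (simp add: open_enat)
  next
    case False
    \<comment> \<open>A cofinite set of entries is truncated to \<open>\<infinity>\<close>, and
      cofinite sets are open.\<close>
    have "E i = - {e. e < enat n}"
    proof -
      have "trunc n y i = \<infinity>" using False by (auto simp: trunc_def split: if_splits)
      then show ?thesis by (auto simp: E_def split: if_splits)
    qed
    then show ?thesis using fin by (simp add: finite_imp_closed open_Compl)
  qed
  then have "open (\<Inter>i<n. (\<lambda>y'. y' i) -` E i)"
    by (intro open_INT ballI open_vimage) auto
  also have "(\<Inter>i<n. (\<lambda>y'. y' i) -` E i) = {y'. trunc n y' = trunc n y}"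
    by (auto simp: E_def trunc_def fun_eq_iff)
  finally show ?thesis .
qed

text \<open>The index of the set of stage \<open>n\<close> that contains the point chosen for \<open>y\<close> at stage \<open>m\<close>.\<close>

definition position :: "nat \<Rightarrow> nat \<Rightarrow> (nat \<Rightarrow> enat) \<Rightarrow> nat" where
  "position n m y = (LEAST j. j = n \<or> (\<exists>b. n \<le> b \<and> b < m \<and> y j = enat b))"

lemma position_le: "position n m y \<le> n"
  unfolding position_def by (rule Least_le) simp

lemma position_cases: "position n m y = n \<or> (\<exists>b. n \<le> b \<and> b < m \<and> y (position n m y) = enat b)"
  unfolding position_def by (rule LeastI[of _ n]) simp

lemma position_le_if: "n \<le> b \<Longrightarrow> b < m \<Longrightarrow> y k = enat b \<Longrightarrow> position n m y \<le> k"
  unfolding position_def by (rule Least_le) auto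

lemma position_self: "position n n y = n"
  using position_cases[of n n y] by auto

text \<open>The minimum matches the index \<open>min i (fresh n y)\<close> in
  \<open>refines\<close>, so that following the refinements down from stage \<open>m\<close> yields
  the positions.\<close>

lemma position_Suc:
  assumes "n < m"
  shows "position n m y = min (position (Suc n) m y) (fresh n y)"
proof (rule antisym)
  have "position n m y \<le> fresh n y"
    using fresh_cases[of n y] position_le[of n m y] position_le_if[of n n m y] assms by (metis order_refl)
  moreover have "position n m y \<le> position (Suc n) m y"
    using position_cases[of "Suc n" m y] position_le[of n m y] position_le_if[of n _ m y]
    by (metis Suc_leD le_SucI)
  ultimately show "position n m y \<le> min (position (Suc n) m y) (fresh n y)" by simp
  show "min (position (Suc n) m y) (fresh n y) \<le> position n m y"
    using position_cases[of n m y]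
  proof
    assume "\<exists>b. n \<le> b \<and> b < m \<and> y (position n m y) = enat b"
    then obtain b where b: "n \<le> b" "b < m" "y (position n m y) = enat b" by blast
    show ?thesis
    proof (cases "b = n")
      case True
      then show ?thesis using fresh_le_if[of y "position n m y" n] b(3) by simp
    next
      case False
      then have "position (Suc n) m y \<le> position n m y" using position_le_if[of "Suc n" b m y] b by simp
      then show ?thesis by simp
    qed
  qed (use fresh_le[of n y] in simp)
qed

section \<open>The limit of the chosen points\<close>

context continuous_lift
begin

lemma continuous_F: "continuous_on UNIV F"
  using continuous_fp by (simp add: F_def comp_def cong: continuous_on_cong)

text \<open>The first property makes \<phi> continuous for the order topology on the entries, the
  second makes \<psi> continuous, where entries count as discrete, and the third makes both
  injective and the inverse of \<psi> continuous.\<close>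

lemma ex_limit_map:
  obtains g :: "(nat \<Rightarrow> enat) \<Rightarrow> nat \<Rightarrow> nat" where
    "continuous_on UNIV (\<lambda>y. p (g y))"
    "\<forall>y l. \<exists>N. \<forall>y'. (\<forall>i<N. y' i = y i) \<longrightarrow> (\<forall>k<l. g y' k = g y k)"
    "\<forall>y l. \<exists>H. \<forall>y'. (\<forall>k<H. F (g y') k = F (g y) k) \<longrightarrow> (\<forall>i<l. y' i = y i)"
proof -
  obtain X h where "\<forall>n. stage n (X n) (h n)" "\<forall>n. refines n (X n) (X (Suc n))"
    by (rule ex_stages)
  then have X: "stage n (X n) (h n)" "refines n (X n) (X (Suc n))" for n
    by simp_all
  define W where "W n y = X n (trunc n y)" for n y
  have W_cong: "W n y = W n y'" if "trunc n y = trunc n y'" for n y y'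
    using that by (simp add: W_def)
  note R = bspec[OF X(2)[unfolded refines_def], OF rangeI]
  have W_Suc: "W (Suc n) y i \<subseteq> W n y (min i (fresh n y))" if "i \<le> Suc n" for n y i
  proof -
    have "X (Suc n) (trunc (Suc n) y) i \<subseteq> X n (trunc n (trunc (Suc n) y)) (min i (fresh n (trunc (Suc n) y)))"
      by (rule R[THEN conjunct1, rule_format, OF that])
    then show ?thesis by (simp add: W_def trunc_trunc fresh_trunc)
  qed
  have W_agree: "a k = b k" if "a \<in> W (Suc n) y i" "b \<in> W (Suc n) y j" "i \<le> Suc n" "j \<le> Suc n"
    "fresh n y \<le> i" "fresh n y \<le> j" "k \<le> n" for a b k n y i j
  proof -
    have "\<forall>i\<le>Suc n. \<forall>j\<le>Suc n. fresh n y \<le> i \<longrightarrow> fresh n y \<le> j \<longrightarrow>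
        (\<forall>a\<in>W (Suc n) y i. \<forall>b\<in>W (Suc n) y j. \<forall>k\<le>n. a k = b k)"
      using R[THEN conjunct2, THEN conjunct1, of n y] unfolding W_def fresh_trunc .
    then show ?thesis using that by blast
  qed
  have W_dist: "dist (p a) (p b) < (1/2)^n" if "a \<in> W (Suc n) y i" "b \<in> W (Suc n) y j"
    "i \<le> Suc n" "j \<le> Suc n" for a b n y i j
  proof -
    have "\<forall>i\<le>Suc n. \<forall>j\<le>Suc n. \<forall>a\<in>W (Suc n) y i. \<forall>b\<in>W (Suc n) y j. dist (p a) (p b) < (1/2)^n"
      using R[THEN conjunct2, THEN conjunct2, of n y] unfolding W_def .
    then show ?thesis using that by blast
  qed
  define c where "c n y = (SOME x. x \<in> W n y n)" for n y
  have c_in: "c n y \<in> W n y n" for n y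
  proof -
    have "chain n (W n y)" unfolding W_def by (rule stage_chain[OF X(1)]) (rule rangeI)
    then have "W n y n \<noteq> {}" using small_empty by (auto simp: chain_def)
    then show ?thesis unfolding c_def by (rule some_in_eq[THEN iffD2])
  qed
  have c_pos: "c m y \<in> W n y (position n m y)" if "n \<le> m" for n m y
    using that
  proof (induction n rule: inc_induct)
    case base
    show ?case using c_in by (simp add: position_self)
  next
    case (step n)
    then show ?case
      using W_Suc[OF position_le[of "Suc n" m y], of y] position_Suc[OF step(2), of y] by auto
  qed
  have ex_N: "\<exists>N. l \<le> N \<and> (\<forall>i<l. \<forall>b. y i = enat b \<longrightarrow> b < N) \<and>
      (\<forall>y'. (\<forall>i<N. y' i = y i) \<longrightarrow> (\<forall>m\<ge>N. \<forall>k<l. c m y' k = c N y k))" for y :: "nat \<Rightarrow> enat" and l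
  proof -
    define R where "R n \<longleftrightarrow> l \<le> n \<and> (\<forall>i<l. \<forall>b. y i = enat b \<longrightarrow> b < n)" for n
    define B where "B = {b. \<exists>i<l. y i = enat b}"
    have "B \<subseteq> (\<lambda>i. the_enat (y i)) ` {..<l}" by (force simp: B_def)
    then have "finite B" by (rule finite_subset) simp
    then obtain n0 where "B \<subseteq> {..<n0}" using finite_nat_bounded by blast
    then have "R (max l n0)" by (fastforce simp: R_def B_def)
    \<comment> \<open>Minimality forces \<open>fresh (n - 1) y \<le> l\<close>: either
      \<open>n = l\<close> or an entry before \<open>l\<close> equals \<open>n - 1\<close>. So all
      points in the sets of stage \<open>n\<close> from index \<open>l\<close> on share their first
      \<open>n\<close> coordinates. Later points stay in these sets, since every entry before
      \<open>l\<close> is infinite or below \<open>n\<close>.\<close>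
    define n where "n = (LEAST n. R n)"
    have "R n" unfolding n_def using \<open>R (max l n0)\<close> by (rule LeastI)
    have min: "\<not> R n'" if "n' < n" for n' using that not_less_Least unfolding n_def by blast
    have "c m y' k = c n y k" if y': "\<forall>i<n. y' i = y i" and "n \<le> m" "k < l" for y' m k
    proof -
      obtain n' where n': "n = Suc n'" using \<open>R n\<close> \<open>k < l\<close> by (cases n) (auto simp: R_def)
      have "trunc n y' = trunc n y" using y' by (auto simp: trunc_def fun_eq_iff)
      have pos: "l \<le> position n m y'"
      proof (rule ccontr)
        assume "\<not> l \<le> position n m y'"
        then have lt: "position n m y' < l" by simp
        then have "position n m y' < n" using \<open>R n\<close> by (simp add: R_def)
        then obtain b where b: "n \<le> b" "y' (position n m y') = enat b"
          using position_cases[of n m y'] by auto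
        then have "y (position n m y') = enat b" using y' \<open>position n m y' < n\<close> by simp
        then show False using \<open>R n\<close> lt b(1) unfolding R_def by (meson leD)
      qed
      have fresh: "fresh n' y \<le> i" if "l \<le> i" "i \<le> n" for i
      proof (cases "l \<le> n'")
        case True
        then obtain i' b where b: "i' < l" "y i' = enat b" "n' \<le> b"
          using min[of n'] n' by (auto simp: R_def not_less)
        then have "b = n'" using \<open>R n\<close> n' by (auto simp: R_def)
        then show ?thesis using fresh_le_if[of y i' n'] b that by simp
      next
        case False
        then have "n' \<le> i" using that n' by simp
        then show ?thesis using fresh_le[of n' y] by simp
      qed
      have "c m y' \<in> W n y (position n m y')"
        using c_pos[OF \<open>n \<le> m\<close>] W_cong[OF \<open>trunc n y' = trunc n y\<close>] by metis
      then show ?thesis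
        using W_agree[of "c m y'" n' y "position n m y'" "c n y" n k] c_in[of n y] fresh[of n]
          fresh[OF pos position_le] position_le[of n m y'] \<open>R n\<close> \<open>k < l\<close>
        by (simp add: n' R_def)
    qed
    then show ?thesis using \<open>R n\<close> unfolding R_def by blast
  qed
  define N where "N y l = (SOME N. l \<le> N \<and> (\<forall>i<l. \<forall>b. y i = enat b \<longrightarrow> b < N) \<and>
      (\<forall>y'. (\<forall>i<N. y' i = y i) \<longrightarrow> (\<forall>m\<ge>N. \<forall>k<l. c m y' k = c N y k)))" for y :: "nat \<Rightarrow> enat" and l
  have "l \<le> N y l \<and> (\<forall>i<l. \<forall>b. y i = enat b \<longrightarrow> b < N y l) \<and>
      (\<forall>y'. (\<forall>i<N y l. y' i = y i) \<longrightarrow> (\<forall>m\<ge>N y l. \<forall>k<l. c m y' k = c (N y l) y k))" for y l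
    unfolding N_def by (rule someI_ex[OF ex_N])
  then have N_ge: "\<And>y l. l \<le> N y l"
    and N_val: "\<And>y l i b. i < l \<Longrightarrow> y i = enat b \<Longrightarrow> b < N y l"
    and N_eq: "\<And>y l y' m k. (\<And>i. i < N y l \<Longrightarrow> y' i = y i) \<Longrightarrow> N y l \<le> m \<Longrightarrow> k < l \<Longrightarrow>
      c m y' k = c (N y l) y k"
    by auto
  \<comment> \<open>From stage \<open>N y (Suc k)\<close> on, coordinate \<open>k\<close> of the
    chosen points is constant.\<close>
  define g where "g y k = c (N y (Suc k)) y k" for y k
  have c_g: "c m y k = g y k" if "N y l \<le> m" "k < l" for m y k l
  proof -
    let ?m = "max m (N y (Suc k))"
    have "c m y k = c (N y l) y k" using that by (intro N_eq) simp_all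
    also have "\<dots> = c ?m y k" using that by (intro N_eq[symmetric]) simp_all
    also have "\<dots> = g y k" unfolding g_def by (intro N_eq) simp_all
    finally show ?thesis .
  qed
  have g_local: "g y' k = g y k" if "\<And>i. i < N y l \<Longrightarrow> y' i = y i" "k < l" for y y' l k
  proof -
    let ?m = "max (N y l) (N y' l)"
    have "g y' k = c ?m y' k" using that(2) by (intro c_g[symmetric, of _ l]) simp_all
    also have "\<dots> = c (N y l) y k" using that by (intro N_eq) simp_all
    also have "\<dots> = g y k" using that(2) by (intro c_g[of _ l]) simp_all
    finally show ?thesis .
  qed
  have c_lim: "(\<lambda>m. c m y) \<longlonglongrightarrow> g y" for y
    using c_g by (intro tendsto_if_eventually_agree) blast
  have p_lim: "(\<lambda>m. p (c m y)) \<longlonglongrightarrow> p (g y)" for y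
    using continuous_on_tendsto_compose[OF continuous_p c_lim] by simp
  have cont: "continuous_on UNIV (\<lambda>y. p (g y))"
    unfolding continuous_on_topological
  proof (intro ballI allI impI)
    fix y B assume "open B" "p (g y) \<in> B"
    then obtain e where e: "e > 0" "ball (p (g y)) e \<subseteq> B" by (meson openE)
    obtain n where n: "(1/2)^n < e" using real_arch_pow_inv[OF e(1), of "1/2"] by auto
    \<comment> \<open>Equal truncations put both points into sets of one chain, possibly at
      different positions; the distance bound holds across the whole chain and passes to the
      limit.\<close>
    have "p (g y') \<in> B" if "trunc (Suc n) y' = trunc (Suc n) y" for y'
    proof -
      have "dist (p (c m y)) (p (c m y')) \<le> (1/2)^n" if "Suc n \<le> m" for m
      proof (rule less_imp_le, rule W_dist)
        show "c m y \<in> W (Suc n) y (position (Suc n) m y)"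
          using c_pos[OF that] .
        show "c m y' \<in> W (Suc n) y (position (Suc n) m y')"
          using c_pos[OF that] W_cong[OF \<open>trunc (Suc n) y' = trunc (Suc n) y\<close>] by metis
      qed (rule position_le)+
      then have "dist (p (g y)) (p (g y')) \<le> (1/2)^n"
        by (intro LIMSEQ_le_const2[OF tendsto_dist[OF p_lim p_lim]]) blast
      then show ?thesis using n e(2) by auto
    qed
    then show "\<exists>A. open A \<and> y \<in> A \<and> (\<forall>y'\<in>UNIV. y' \<in> A \<longrightarrow> p (g y') \<in> B)"
      using open_trunc_eq[of "Suc n" y] by (intro exI[of _ "{y'. trunc (Suc n) y' = trunc (Suc n) y}"]) auto
  qed
  have loc: "\<exists>N. \<forall>y'. (\<forall>i<N. y' i = y i) \<longrightarrow> (\<forall>k<l. g y' k = g y k)" for y l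
    using g_local by blast
  have det: "\<exists>H. \<forall>y'. (\<forall>k<H. F (g y') k = F (g y) k) \<longrightarrow> (\<forall>i<l. y' i = y i)" for y l
  proof (intro exI allI impI)
    fix y' i
    let ?n = "N y l"
    \<comment> \<open>The witness is \<open>h ?n\<close>, which depends on \<open>y\<close> and
      \<open>l\<close> only; the stage \<open>m\<close> chosen below may depend on
      \<open>y'\<close>.\<close>
    assume eq: "\<forall>k<h ?n. F (g y') k = F (g y) k" and "i < l"
    have ev: "\<forall>\<^sub>F m in sequentially. \<forall>k<h ?n. F (c m z) k = F (g z) k" for z
    proof -
      have "(\<lambda>m. F (c m z)) \<longlonglongrightarrow> F (g z)"
        using continuous_on_tendsto_compose[OF continuous_F c_lim] by simp
      then show ?thesis
        using topological_tendstoD[of _ "F (g z)", OF _ open_agree[of "h ?n" "F (g z)"]] by simp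
    qed
    have "\<forall>\<^sub>F m in sequentially. (\<forall>k<h ?n. F (c m y) k = F (g y) k) \<and>
        (\<forall>k<h ?n. F (c m y') k = F (g y') k) \<and> m \<ge> ?n \<and> m \<ge> N y' l"
      by (intro eventually_conj ev eventually_ge_at_top)
    \<comment> \<open>The condition \<open>m \<ge> N y' l\<close> puts the finite entries of
      \<open>y'\<close> before \<open>l\<close> below \<open>m\<close>, so that
      \<open>position\<close> notices those that are not below \<open>?n\<close>.\<close>
    from eventually_happens'[OF sequentially_bot this]
    obtain m where m: "\<forall>k<h ?n. F (c m y) k = F (g y) k"
      "\<forall>k<h ?n. F (c m y') k = F (g y') k" "m \<ge> ?n" "m \<ge> N y' l"
      by blast
    define j where "j = position ?n m y"
    define j' where "j' = position ?n m y'"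
    have F_eq: "F (c m y) k = F (c m y') k" if "k < h ?n" for k
      using m(1,2) eq that by simp
    have not_sep: "\<not> separated (h ?n) (W ?n y j) (W ?n y' j')"
      using c_pos[OF m(3), of y] c_pos[OF m(3), of y'] F_eq
      unfolding separated_def j_def j'_def by blast
    have real: "trunc ?n z (position ?n m z) = \<infinity>" if "position ?n m z < ?n" for z
      using position_cases[of ?n m z] that by (auto simp: trunc_def)
    have "j = j' \<and> (\<forall>i<j. trunc ?n y i = trunc ?n y' i)"
    proof (rule ccontr)
      assume neq: "\<not> (j = j' \<and> (\<forall>i<j. trunc ?n y i = trunc ?n y' i))"
      have "separated (h ?n) (W ?n y j) (W ?n y' j')"
        unfolding W_def
        by (rule stage_separated[OF X(1) rangeI rangeI _ _ _ _ neq])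
          (auto simp: j_def j'_def position_le real)
      then show False using not_sep by simp
    qed
    then have jj': "j = j'" "\<And>i. i < j \<Longrightarrow> trunc ?n y i = trunc ?n y' i" by auto
    have "l \<le> j"
    proof (rule ccontr)
      assume "\<not> l \<le> j"
      then have "j < l" "j < ?n" using N_ge[of l y] by auto
      then obtain b where "?n \<le> b" "y j = enat b"
        using position_cases[of ?n m y] unfolding j_def by auto
      then show False using N_val[OF \<open>j < l\<close>, of y b] by simp
    qed
    then have "i < j" "i < ?n" using \<open>i < l\<close> N_ge[of l y] by auto
    have "y' i < enat ?n \<or> y' i = \<infinity>"
    proof (cases "y' i")
      case (enat b)
      then have "b < m" using N_val[OF \<open>i < l\<close>] m(4) by (meson less_le_trans)
      then have "b < ?n"
        using position_le_if[of ?n b m y' i] enat \<open>i < j\<close> jj'(1) unfolding j'_def by (meson leD leI)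
      then show ?thesis using enat by simp
    qed simp
    moreover have "y i < enat ?n \<or> y i = \<infinity>"
      using N_val[OF \<open>i < l\<close>, of y] by (cases "y i") auto
    ultimately show "y' i = y i"
      using jj'(2)[OF \<open>i < j\<close>] \<open>i < ?n\<close> by (auto simp: trunc_def split: if_splits)
  qed
  show ?thesis by (intro that[of g] allI cont loc det)
qed

lemma ex_embeddings:
  "\<exists>(\<phi> :: (nat \<Rightarrow> enat) \<Rightarrow> 'a) (\<psi> :: (nat \<Rightarrow> nat) \<Rightarrow> (nat \<Rightarrow> nat)).
     embedding_map euclidean euclidean \<phi> \<and> embedding_map euclidean euclidean \<psi> \<and>
     \<psi> \<circ> pawlikowski = f \<circ> \<phi>"
proof -
  obtain g :: "(nat \<Rightarrow> enat) \<Rightarrow> nat \<Rightarrow> nat" where g: "continuous_on UNIV (\<lambda>y. p (g y))"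
    "\<forall>y l. \<exists>N. \<forall>y'. (\<forall>i<N. y' i = y i) \<longrightarrow> (\<forall>k<l. g y' k = g y k)"
    "\<forall>y l. \<exists>H. \<forall>y'. (\<forall>k<H. F (g y') k = F (g y) k) \<longrightarrow> (\<forall>i<l. y' i = y i)"
    by (rule ex_limit_map)
  \<comment> \<open>The inverse of \<open>pawlikowski\<close>; it acts entry by entry, so agreement
    on finitely many entries transfers in both directions.\<close>
  define Q where "Q x i = (case x i of 0 \<Rightarrow> \<infinity> | Suc k \<Rightarrow> enat k)" for x :: "nat \<Rightarrow> nat" and i :: nat
  have Q_inj: "Q x i = Q x' i \<longleftrightarrow> x i = x' i" for x x' i
    by (auto simp: Q_def split: nat.splits)
  have Q_pawlikowski: "Q (pawlikowski y) = y" for y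
    by (auto simp: Q_def pawlikowski_def fun_eq_iff split: enat.splits)
  define \<psi> where "\<psi> x = F (g (Q x))" for x
  have inj_Fg: "y' = y" if "F (g y') = F (g y)" for y y'
  proof
    fix i
    obtain H where "\<forall>y'. (\<forall>k<H. F (g y') k = F (g y) k) \<longrightarrow> (\<forall>j<Suc i. y' j = y j)" using g(3) by blast
    then show "y' i = y i" using that by simp
  qed
  have "continuous_on UNIV (\<lambda>x. g (Q x) k)" for k
  proof (rule continuous_into_discrete, subst open_subopen, rule ballI)
    fix t x assume x: "x \<in> (\<lambda>x. g (Q x) k) -` {t}"
    obtain N where N: "\<forall>y'. (\<forall>i<N. y' i = Q x i) \<longrightarrow> (\<forall>j<Suc k. g y' j = g (Q x) j)"
      using g(2) by blast
    have "{x'. \<forall>i<N. x' i = x i} \<subseteq> (\<lambda>x. g (Q x) k) -` {t}"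
    proof
      fix x' assume "x' \<in> {x'. \<forall>i<N. x' i = x i}"
      then have "\<forall>i<N. Q x' i = Q x i" using Q_inj by simp
      then have "g (Q x') k = g (Q x) k" using N by blast
      then show "x' \<in> (\<lambda>x. g (Q x) k) -` {t}" using x by simp
    qed
    then show "\<exists>T. open T \<and> x \<in> T \<and> T \<subseteq> (\<lambda>x. g (Q x) k) -` {t}"
      using open_agree[of N x] by (intro exI[of _ "{x'. \<forall>i<N. x' i = x i}"] conjI) simp_all
  qed
  then have "continuous_on UNIV (\<lambda>x. g (Q x))"
    by (rule continuous_on_coordinatewise_then_product)
  then have "continuous_on UNIV \<psi>"
    unfolding \<psi>_def by (rule continuous_on_compose2[OF continuous_F]) simp
  moreover have "\<exists>H. \<forall>x'. (\<forall>k<H. \<psi> x' k = \<psi> x k) \<longrightarrow> (\<forall>i<l. x' i = x i)" for x l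
    using g(3)[rule_format, of "Q x" l] unfolding \<psi>_def by (metis Q_inj)
  ultimately have "embedding_map euclidean euclidean \<psi>"
    by (rule embedding_map_if_determined)
  moreover have "inj (\<lambda>y. p (g y))"
    by (rule injI) (auto intro: inj_Fg simp: F_def)
  then have "embedding_map euclidean euclidean (\<lambda>y. p (g y))"
    using g(1) compact_space_enat_fun by (intro continuous_imp_embedding_map) auto
  moreover have "\<psi> \<circ> pawlikowski = f \<circ> (\<lambda>y. p (g y))"
    by (auto simp: \<psi>_def Q_pawlikowski F_def)
  ultimately show ?thesis by blast
qed

end

theorem theorem5:
  fixes f :: "'a::polish_space \<Rightarrow> (nat \<Rightarrow> nat)"
  assumes "f \<in> borel_measurable borel"
    and "\<not> sigma_continuous f"
  shows "\<exists>(\<phi> :: (nat \<Rightarrow> enat) \<Rightarrow> 'a) (\<psi> :: (nat \<Rightarrow> nat) \<Rightarrow> (nat \<Rightarrow> nat)).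
           embedding_map euclidean euclidean \<phi> \<and>
           embedding_map euclidean euclidean \<psi> \<and>
           \<psi> \<circ> pawlikowski = f \<circ> \<phi>"
proof -
  obtain p :: "(nat \<Rightarrow> nat) \<Rightarrow> 'a"
    where "continuous_on UNIV p" "surj p" "continuous_on UNIV (f \<circ> p)"
    using borel_continuous_lift[OF assms(1)] .
  then interpret continuous_lift p f
    using assms(2) by unfold_locales
  show ?thesis by (rule ex_embeddings)
qed

end
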